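(* There is a $1$-parameter family of pairwise non-isomorphic connected and simply connected $10$-dimensional nilpotent Lie groups $N_t$ such that every group $N_t$ of the family admits a $3$-parameter family of left-invariant Riemannian geodesic orbit metrics.
   Context: A Riemannian manifold $(M,g)$ is called a geodesic orbit manifold (and $g$ a geodesic orbit metric) if every geodesic of $(M,g)$ is an orbit of a $1$-parameter subgroup of the full isometry group of $(M,g)$. Metrics on nilpotent Lie groups are considered to be left-invariant Riemannian metrics. Families are continuous families depending on real parameters; Lie groups and Lie algebras are real. *)

theory Defs
  imports "HOL-Analysis.Analysis" "HOL-Algebra.Generated_Groups"
begin

section \<open>Smooth manifolds\<close>

text \<open>The following two predicates are meant for open sets only.\<close>

primrec C_k_on :: "nat \<Rightarrow> ('a::euclidean_space \<Rightarrow> 'b::real_normed_vector) \<Rightarrow> 'a set \<Rightarrow> bool" where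
  "C_k_on 0 f S \<longleftrightarrow> continuous_on S f"
| "C_k_on (Suc k) f S \<longleftrightarrow> (\<forall>x\<in>S. f differentiable (at x)) \<and>
     (\<forall>v. C_k_on k (\<lambda>x. frechet_derivative f (at x) v) S)"

definition smooth_on :: "('a::euclidean_space \<Rightarrow> 'b::real_normed_vector) \<Rightarrow> 'a set \<Rightarrow> bool" where
  "smooth_on f S \<longleftrightarrow> (\<forall>k. C_k_on k f S)"

text \<open>A chart is a pair of a domain and a coordinate map into the model space \<open>'e\<close>, whose
  dimension is the dimension of the manifold. The set of charts is an atlas; it need not be maximal.\<close>

type_synonym ('p, 'e) chart = "'p set \<times> ('p \<Rightarrow> 'e)"

record ('p, 'e) manifold =
  mtop :: "'p topology"
  charts :: "('p, 'e) chart set"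

definition chart_image :: "('p, 'e) chart \<Rightarrow> 'e set" where
  "chart_image c = snd c ` fst c"

definition coord_rep :: "('p, 'e) chart \<Rightarrow> ('q, 'f) chart \<Rightarrow> ('p \<Rightarrow> 'q) \<Rightarrow> 'e \<Rightarrow> 'f" where
  "coord_rep c d f = snd d \<circ> f \<circ> inv_into (fst c) (snd c)"

definition smooth_manifold :: "('p, 'e::euclidean_space) manifold \<Rightarrow> bool" where
  "smooth_manifold M \<longleftrightarrow>
     Hausdorff_space (mtop M) \<and>
     (\<exists>\<B>. countable \<B> \<and> (\<forall>V\<in>\<B>. openin (mtop M) V) \<and>
        (\<forall>U x. openin (mtop M) U \<and> x \<in> U \<longrightarrow> (\<exists>V\<in>\<B>. x \<in> V \<and> V \<subseteq> U))) \<and>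
     (\<Union>c\<in>charts M. fst c) = topspace (mtop M) \<and>
     (\<forall>c\<in>charts M. openin (mtop M) (fst c) \<and> open (chart_image c) \<and>
        homeomorphic_map (subtopology (mtop M) (fst c)) (top_of_set (chart_image c)) (snd c)) \<and>
     (\<forall>c\<in>charts M. \<forall>d\<in>charts M.
        smooth_on (coord_rep c d (\<lambda>p. p)) (snd c ` (fst c \<inter> fst d)))"

definition prod_manifold ::
  "('p, 'e) manifold \<Rightarrow> ('q, 'f) manifold \<Rightarrow> ('p \<times> 'q, 'e \<times> 'f) manifold" where
  "prod_manifold M N =
     \<lparr> mtop = prod_topology (mtop M) (mtop N),
       charts = {(fst c \<times> fst d, map_prod (snd c) (snd d)) | c d. c \<in> charts M \<and> d \<in> charts N} \<rparr>"

definition smooth_map ::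
  "('p, 'e::euclidean_space) manifold \<Rightarrow> ('q, 'f::euclidean_space) manifold \<Rightarrow> ('p \<Rightarrow> 'q) \<Rightarrow> bool" where
  "smooth_map M N f \<longleftrightarrow>
     continuous_map (mtop M) (mtop N) f \<and>
     (\<forall>c\<in>charts M. \<forall>d\<in>charts N.
        smooth_on (coord_rep c d f) (snd c ` {p \<in> fst c. f p \<in> fst d}))"

definition diffeomorphism ::
  "('p, 'e::euclidean_space) manifold \<Rightarrow> ('q, 'f::euclidean_space) manifold \<Rightarrow> ('p \<Rightarrow> 'q) \<Rightarrow> bool" where
  "diffeomorphism M N f \<longleftrightarrow>
     bij_betw f (topspace (mtop M)) (topspace (mtop N)) \<and>
     smooth_map M N f \<and> smooth_map N M (inv_into (topspace (mtop M)) f)"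

text \<open>The counterpart of \<^const>\<open>simply_connected\<close> for abstract topologies.\<close>

definition simply_connected_space :: "'p topology \<Rightarrow> bool" where
  "simply_connected_space X \<longleftrightarrow>
     (\<forall>p q. pathin X p \<and> p 1 = p 0 \<and> pathin X q \<and> q 1 = q 0 \<longrightarrow>
        homotopic_with (\<lambda>r. r 1 = r 0) (top_of_set {0..1}) X p q)"


section \<open>Lie groups\<close>

record ('p, 'e) lie_structure = "'p monoid" +
  manifold :: "('p, 'e) manifold"

definition lie_group :: "('p, 'e::euclidean_space) lie_structure \<Rightarrow> bool" where
  "lie_group G \<longleftrightarrow>
     group G \<and> smooth_manifold (manifold G) \<and> topspace (mtop (manifold G)) = carrier G \<and>
     smooth_map (prod_manifold (manifold G) (manifold G)) (manifold G)
       (\<lambda>(x, y). x \<otimes>\<^bsub>G\<^esub> y) \<and>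
     smooth_map (manifold G) (manifold G) (\<lambda>x. inv\<^bsub>G\<^esub> x)"

definition lie_isomorphic ::
  "('p, 'e::euclidean_space) lie_structure \<Rightarrow> ('q, 'f::euclidean_space) lie_structure \<Rightarrow> bool" where
  "lie_isomorphic G H \<longleftrightarrow> (\<exists>f \<in> iso G H. diffeomorphism (manifold G) (manifold H) f)"

primrec lower_central_series :: "('a, 'b) monoid_scheme \<Rightarrow> nat \<Rightarrow> 'a set" where
  "lower_central_series G 0 = carrier G"
| "lower_central_series G (Suc n) =
     generate G (\<Union>x\<in>carrier G. \<Union>y\<in>lower_central_series G n.
       {x \<otimes>\<^bsub>G\<^esub> y \<otimes>\<^bsub>G\<^esub> inv\<^bsub>G\<^esub> x \<otimes>\<^bsub>G\<^esub> inv\<^bsub>G\<^esub> y})"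

definition nilpotent_group :: "('a, 'b) monoid_scheme \<Rightarrow> bool" where
  "nilpotent_group G \<longleftrightarrow> group G \<and> (\<exists>n. lower_central_series G n = {\<one>\<^bsub>G\<^esub>})"

text \<open>A continuous family of Lie groups: group structures on one and the same manifold whose
  operations are continuous jointly in the parameter and the group elements.\<close>

definition continuous_lie_family ::
  "'t::topological_space set \<Rightarrow> ('t \<Rightarrow> ('p, 'e::euclidean_space) lie_structure) \<Rightarrow> bool" where
  "continuous_lie_family I N \<longleftrightarrow>
     (\<forall>t\<in>I. lie_group (N t)) \<and>
     (\<exists>M. (\<forall>t\<in>I. manifold (N t) = M) \<and>
        continuous_map (prod_topology (top_of_set I) (prod_topology (mtop M) (mtop M))) (mtop M)
          (\<lambda>(t, x, y). x \<otimes>\<^bsub>N t\<^esub> y) \<and>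
        continuous_map (prod_topology (top_of_set I) (mtop M)) (mtop M)
          (\<lambda>(t, x). inv\<^bsub>N t\<^esub> x))"


section \<open>Riemannian metrics\<close>

text \<open>A metric tensor is given by its components: \<open>g c x v w\<close> is the value at the point with
  coordinates \<open>x\<close> in the chart \<open>c\<close> on the vectors with components \<open>v\<close>, \<open>w\<close> in that chart.
  Only \<open>c \<in> charts M\<close> and \<open>x \<in> chart_image c\<close> matter.\<close>

type_synonym ('p, 'e) metric_tensor = "('p, 'e) chart \<Rightarrow> 'e \<Rightarrow> 'e \<Rightarrow> 'e \<Rightarrow> real"

definition preserves_metric ::
  "('p, 'e::euclidean_space) manifold \<Rightarrow> ('p, 'e) metric_tensor \<Rightarrow> ('p \<Rightarrow> 'p) \<Rightarrow> bool" where
  "preserves_metric M g f \<longleftrightarrow>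
     (\<forall>c\<in>charts M. \<forall>d\<in>charts M. \<forall>p\<in>fst c. f p \<in> fst d \<longrightarrow>
        (\<forall>v w. g c (snd c p) v w =
           g d (snd d (f p))
             (frechet_derivative (coord_rep c d f) (at (snd c p)) v)
             (frechet_derivative (coord_rep c d f) (at (snd c p)) w)))"

text \<open>The last conjunct is the transformation law of the components under change of chart.\<close>

definition riemannian_metric ::
  "('p, 'e::euclidean_space) manifold \<Rightarrow> ('p, 'e) metric_tensor \<Rightarrow> bool" where
  "riemannian_metric M g \<longleftrightarrow>
     (\<forall>c\<in>charts M. \<forall>x\<in>chart_image c.
        bilinear (g c x) \<and> (\<forall>v w. g c x v w = g c x w v) \<and> (\<forall>v. v \<noteq> 0 \<longrightarrow> g c x v v > 0)) \<and>
     (\<forall>c\<in>charts M. \<forall>v w. smooth_on (\<lambda>x. g c x v w) (chart_image c)) \<and>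
     preserves_metric M g (\<lambda>p. p)"

definition isometry ::
  "('p, 'e::euclidean_space) manifold \<Rightarrow> ('p, 'e) metric_tensor \<Rightarrow> ('p \<Rightarrow> 'p) \<Rightarrow> bool" where
  "isometry M g f \<longleftrightarrow> diffeomorphism M M f \<and> preserves_metric M g f"

definition left_invariant_metric ::
  "('p, 'e::euclidean_space) lie_structure \<Rightarrow> ('p, 'e) metric_tensor \<Rightarrow> bool" where
  "left_invariant_metric G g \<longleftrightarrow>
     riemannian_metric (manifold G) g \<and>
     (\<forall>a\<in>carrier G. preserves_metric (manifold G) g (\<lambda>x. a \<otimes>\<^bsub>G\<^esub> x))"

text \<open>Christoffel symbols of the first kind of a metric \<open>h\<close> on an open subset of \<open>'e\<close>, i.e.
  the inner product with \<open>z\<close> of the covariant derivative of the constant field \<open>w\<close> along \<open>v\<close>.\<close>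

definition christoffel ::
  "('e::euclidean_space \<Rightarrow> 'e \<Rightarrow> 'e \<Rightarrow> real) \<Rightarrow> 'e \<Rightarrow> 'e \<Rightarrow> 'e \<Rightarrow> 'e \<Rightarrow> real" where
  "christoffel h x v w z =
     (frechet_derivative (\<lambda>y. h y w z) (at x) v
      + frechet_derivative (\<lambda>y. h y v z) (at x) w
      - frechet_derivative (\<lambda>y. h y v w) (at x) z) / 2"

text \<open>The last line says that the covariant acceleration is orthogonal to every vector \<open>z\<close>;
  as the metric is nondegenerate, this is the vanishing of the covariant acceleration.\<close>

definition geodesic_on ::
  "('p, 'e::euclidean_space) manifold \<Rightarrow> ('p, 'e) metric_tensor \<Rightarrow> real set \<Rightarrow> (real \<Rightarrow> 'p) \<Rightarrow> bool" where
  "geodesic_on M g S \<gamma> \<longleftrightarrow>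
     open S \<and> is_interval S \<and> continuous_map (top_of_set S) (mtop M) \<gamma> \<and>
     (\<forall>c\<in>charts M. \<forall>J. open J \<and> J \<subseteq> S \<and> \<gamma> ` J \<subseteq> fst c \<longrightarrow>
        (\<exists>x' x''. \<forall>t\<in>J.
           ((snd c \<circ> \<gamma>) has_vector_derivative x' t) (at t) \<and>
           (x' has_vector_derivative x'' t) (at t) \<and>
           (\<forall>z. g c (snd c (\<gamma> t)) (x'' t) z
                + christoffel (g c) (snd c (\<gamma> t)) (x' t) (x' t) z = 0)))"

text \<open>Joint continuity is continuity of \<open>\<phi>\<close> as a map into the isometry group with the
  compact-open topology.\<close>

definition one_parameter_isometry_group ::
  "('p, 'e::euclidean_space) manifold \<Rightarrow> ('p, 'e) metric_tensor \<Rightarrow> (real \<Rightarrow> 'p \<Rightarrow> 'p) \<Rightarrow> bool" where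
  "one_parameter_isometry_group M g \<phi> \<longleftrightarrow>
     (\<forall>s. isometry M g (\<phi> s)) \<and>
     (\<forall>s t. \<forall>p\<in>topspace (mtop M). \<phi> (s + t) p = \<phi> s (\<phi> t p)) \<and>
     continuous_map (prod_topology euclideanreal (mtop M)) (mtop M) (\<lambda>(s, p). \<phi> s p)"

text \<open>Geodesics on arbitrary open intervals are considered, so completeness is not presupposed
  but implied.\<close>

definition geodesic_orbit_metric ::
  "('p, 'e::euclidean_space) manifold \<Rightarrow> ('p, 'e) metric_tensor \<Rightarrow> bool" where
  "geodesic_orbit_metric M g \<longleftrightarrow>
     riemannian_metric M g \<and>
     (\<forall>S \<gamma>. geodesic_on M g S \<gamma> \<longrightarrow>
        (\<exists>\<phi>. one_parameter_isometry_group M g \<phi> \<and>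
           (\<exists>p\<in>topspace (mtop M). \<forall>t\<in>S. \<gamma> t = \<phi> t p)))"

definition same_metric ::
  "('p, 'e) manifold \<Rightarrow> ('p, 'e) metric_tensor \<Rightarrow> ('p, 'e) metric_tensor \<Rightarrow> bool" where
  "same_metric M g h \<longleftrightarrow>
     (\<forall>c\<in>charts M. \<forall>x\<in>chart_image c. \<forall>v w. g c x v w = h c x v w)"

definition continuous_metric_family ::
  "('p, 'e::euclidean_space) manifold \<Rightarrow> 't::topological_space set \<Rightarrow>
     ('t \<Rightarrow> ('p, 'e) metric_tensor) \<Rightarrow> bool" where
  "continuous_metric_family M P g \<longleftrightarrow>
     (\<forall>c\<in>charts M. \<forall>v w. continuous_on (P \<times> chart_image c) (\<lambda>(a, x). g a c x v w))"

end

theory Submission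
  imports Defs
begin

text \<open>
  Four vectors in the plane define a two-step nilpotent Lie algebra on
  \<open>(\<real>\<^sup>2)\<^sup>4 \<oplus> \<real>\<^sup>2\<close>: the bracket of two elements of the \<open>j\<close>-th copy of \<open>\<real>\<^sup>2\<close> is the area they
  span times the \<open>j\<close>-th vector, and different copies commute. For any inner product that makes the
  five summands orthogonal, with the Euclidean product rescaled on each copy of \<open>\<real>\<^sup>2\<close>, the map
  \<open>J\<close> with \<open>\<langle>J x, y\<rangle> = \<langle>z, [x, y]\<rangle>\<close>, \<open>z\<close> central, acts on each copy as an infinitesimal rotation.
  It is a skew-symmetric derivation, so every geodesic is an orbit of a one-parameter
  group of left translations composed with rotations, and the scales are free parameters. An
  isomorphism maps the lines of the four vectors, which are the one-dimensional spaces \<open>[x, n]\<close>, to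
  lines of the same kind, so the cross-ratio of the four lines distinguishes the groups.
\<close>

section \<open>Smooth structure of a Euclidean space\<close>

lemma frechet_derivative_eqI:
  assumes "\<And>x. (f has_derivative f' x) (at x)"
  shows "(\<lambda>x. frechet_derivative f (at x) v) = (\<lambda>x. f' x v)"
  using frechet_derivative_at[OF assms] by metis

lemma C_k_on_const: "C_k_on k (\<lambda>x. c) S"
proof (induction k arbitrary: c)
  case (Suc k)
  have "(\<lambda>x. frechet_derivative (\<lambda>x::'a. c) (at x) v) = (\<lambda>x. 0)" for v
    by (rule frechet_derivative_eqI) auto
  then show ?case using Suc by simp
qed simp

lemma C_k_on_affine:
  fixes f :: "'a::euclidean_space \<Rightarrow> 'b::real_normed_vector"
  assumes "bounded_linear f"
  shows "C_k_on k (\<lambda>x. c + f x) S"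
proof (cases k)
  case 0
  then show ?thesis
    using assms by (simp add: continuous_on_add linear_continuous_on)
next
  case (Suc n)
  have d: "((\<lambda>x. c + f x) has_derivative f) (at x)" for x
    using bounded_linear_imp_has_derivative[OF assms]
    by (auto intro!: derivative_eq_intros)
  have "(\<lambda>x. frechet_derivative (\<lambda>x. c + f x) (at x) v) = (\<lambda>x. f v)" for v
    by (rule frechet_derivative_eqI) (rule d)
  then show ?thesis
    using d by (auto simp: Suc C_k_on_const differentiable_def)
qed

text \<open>The derivative of a quadratic map in a fixed direction is affine, so everything reduces
  to \<open>C_k_on_affine\<close>. Both the group law and the components of a left-invariant metric
  are polynomials of this shape.\<close>

lemma smooth_on_quadratic:
  fixes f :: "'a::euclidean_space \<Rightarrow> 'b::real_normed_vector"
  assumes f: "bounded_linear f" and B: "bounded_bilinear B"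
  shows "smooth_on (\<lambda>x. c + f x + B x x) S"
proof -
  have d: "((\<lambda>x. c + f x + B x x) has_derivative (\<lambda>v. f v + (B x v + B v x))) (at x)" for x
    by (auto intro!: derivative_eq_intros bounded_bilinear.FDERIV[OF B]
        bounded_linear_imp_has_derivative[OF f])
  have deriv: "(\<lambda>x. frechet_derivative (\<lambda>x. c + f x + B x x) (at x) v) =
      (\<lambda>x. f v + (B x v + B v x))" for v
    by (rule frechet_derivative_eqI) (rule d)
  have lin: "bounded_linear (\<lambda>x. B x v + B v x)" for v
    by (intro bounded_linear_add bounded_bilinear.bounded_linear_left[OF B]
        bounded_bilinear.bounded_linear_right[OF B])
  have "C_k_on k (\<lambda>x. c + f x + B x x) S" for k
  proof (cases k)
    case 0
    have "continuous_on S (\<lambda>x. c + f x + B x x)"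
      using d by (meson continuous_at_imp_continuous_on has_derivative_continuous)
    then show ?thesis using 0 by simp
  next
    case (Suc n)
    show ?thesis
      using d by (auto simp: Suc deriv C_k_on_affine[OF lin] differentiable_def)
  qed
  then show ?thesis by (simp add: smooth_on_def)
qed

lemma smooth_on_affine:
  assumes "bounded_linear f"
  shows "smooth_on (\<lambda>x. c + f x) S"
  using assms C_k_on_affine smooth_on_def by blast

definition euclidean_manifold :: "('e::euclidean_space, 'e) manifold" where
  "euclidean_manifold = \<lparr>mtop = euclidean, charts = {(UNIV, \<lambda>x. x)}\<rparr>"

lemma euclidean_manifold_simps [simp]:
  "mtop euclidean_manifold = euclidean"
  "charts euclidean_manifold = {(UNIV, \<lambda>x. x)}"
  by (simp_all add: euclidean_manifold_def)

lemma coord_rep_euclidean [simp]: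
  "coord_rep (UNIV, \<lambda>x. x) (UNIV, \<lambda>x. x) f = f"
  by (auto simp: coord_rep_def fun_eq_iff inv_into_f_f[of "\<lambda>x. x" UNIV])

lemma chart_image_euclidean [simp]: "chart_image (UNIV, \<lambda>x. x) = UNIV"
  by (simp add: chart_image_def)

lemma smooth_manifold_euclidean: "smooth_manifold euclidean_manifold"
proof -
  obtain \<B> :: "'a set set" where B: "countable \<B>" "topological_basis \<B>"
    using ex_countable_basis by blast
  have "\<exists>V\<in>\<B>. x \<in> V \<and> V \<subseteq> U" if "open U" "x \<in> U" for U x
    using topological_basisE[OF B(2) that] by metis
  moreover have "open V" if "V \<in> \<B>" for V
    using B(2) that by (rule topological_basis_open)
  ultimately have "\<exists>\<B>. countable \<B> \<and> (\<forall>V\<in>\<B>. open (V :: 'a set)) \<and>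
      (\<forall>U x. open U \<and> x \<in> U \<longrightarrow> (\<exists>V\<in>\<B>. x \<in> V \<and> V \<subseteq> U))"
    using B(1) by blast
  moreover have "homeomorphic_map euclidean euclidean (\<lambda>x::'a. x)"
    by (simp add: homeomorphic_map_id[unfolded id_def])
  moreover have "smooth_on (\<lambda>x::'a. x) UNIV"
    using smooth_on_affine[OF bounded_linear_ident, of 0] by simp
  ultimately show ?thesis
    by (simp add: smooth_manifold_def)
qed

lemma smooth_map_euclidean:
  "smooth_map euclidean_manifold euclidean_manifold f \<longleftrightarrow> smooth_on f UNIV"
proof -
  have "continuous_on UNIV f" if "smooth_on f UNIV"
    using that C_k_on.simps(1) unfolding smooth_on_def by blast
  then show ?thesis
    by (auto simp: smooth_map_def)
qed

lemma prod_manifold_euclidean: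
  "prod_manifold euclidean_manifold euclidean_manifold = euclidean_manifold"
  by (simp add: prod_manifold_def euclidean_manifold_def prod.map_ident)

lemma smooth_map_prod_euclidean:
  assumes "smooth_on f UNIV"
  shows "smooth_map (prod_manifold euclidean_manifold euclidean_manifold) euclidean_manifold f"
  using assms by (simp add: prod_manifold_euclidean smooth_map_euclidean)

text \<open>The straight-line homotopy works: the condition \<open>r 1 = r 0\<close> survives affine
  combinations of two loops.\<close>

lemma simply_connected_space_euclidean:
  "simply_connected_space (euclidean :: 'a::real_normed_vector topology)"
  unfolding simply_connected_space_def
proof (intro allI impI)
  fix p q :: "real \<Rightarrow> 'a"
  assume pq: "pathin euclidean p \<and> p 1 = p 0 \<and> pathin euclidean q \<and> q 1 = q 0"
  let ?h = "\<lambda>(s, r). (1 - s) *\<^sub>R p r + s *\<^sub>R q r"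
  have "continuous_on ({0..1} \<times> {0..1}) ?h"
    using pq unfolding pathin_def split_def
    by (auto intro!: continuous_intros continuous_on_compose2[of "{0..1}" _ _ snd])
  then have "continuous_map (prod_topology (top_of_set {0..1}) (top_of_set {0..1})) euclidean ?h"
    by (simp add: subtopology_Times[symmetric])
  then show "homotopic_with (\<lambda>r. r 1 = r 0) (top_of_set {0..1}) euclidean p q"
    unfolding homotopic_with_def using pq by (intro exI[of _ ?h]) auto
qed

section \<open>Two-step nilpotent groups in exponential coordinates\<close>

text \<open>The Baker-Campbell-Hausdorff product, which stops after the first bracket in the
  two-step case; \<open>b\<close> is half of the Lie bracket.\<close>

definition two_step_group :: "('e \<Rightarrow> 'e \<Rightarrow> 'e) \<Rightarrow> ('e::euclidean_space, 'e) lie_structure" where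
  "two_step_group b = \<lparr>carrier = UNIV, mult = (\<lambda>x y. x + y + b x y), one = 0,
     manifold = euclidean_manifold\<rparr>"

lemma two_step_group_simps [simp]:
  "carrier (two_step_group b) = UNIV"
  "x \<otimes>\<^bsub>two_step_group b\<^esub> y = x + y + b x y"
  "\<one>\<^bsub>two_step_group b\<^esub> = 0"
  "manifold (two_step_group b) = euclidean_manifold"
  by (simp_all add: two_step_group_def)

locale two_step_bracket = bounded_bilinear b
  for b :: "'e::euclidean_space \<Rightarrow> 'e \<Rightarrow> 'e" +
  assumes alternating: "b x x = 0"
    and two_step [simp]: "b (b x y) z = 0"
begin

lemma skew: "b y x = - b x y"
proof -
  have "b x y + b y x = 0"
    using add_left[of x y "x + y"] by (simp add: add_right alternating)
  then show ?thesis by (simp add: eq_neg_iff_add_eq_0 add.commute)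
qed

lemma two_step_right [simp]: "b z (b x y) = 0"
  using skew[of z "b x y"] by simp

abbreviation "mul x y \<equiv> x + y + b x y"

lemmas bilinear_simps = add_left add_right diff_left diff_right minus_left minus_right
  zero_left zero_right

lemma mul_assoc: "mul (mul x y) z = mul x (mul y z)"
  by (simp add: bilinear_simps)

lemma mul_minus_left: "mul (- x) x = 0"
  by (simp add: bilinear_simps alternating)

lemma group_two_step: "group (two_step_group b)"
proof (rule groupI)
  show "\<exists>y\<in>carrier (two_step_group b). y \<otimes>\<^bsub>two_step_group b\<^esub> x = \<one>\<^bsub>two_step_group b\<^esub>" for x
    by (auto simp: bilinear_simps alternating intro!: exI[of _ "- x"])
qed (auto simp: bilinear_simps)

lemma inv_two_step [simp]: "inv\<^bsub>two_step_group b\<^esub> x = - x"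
  using group.inv_equality[OF group_two_step, of "- x" x] by (simp add: bilinear_simps alternating)

lemma commutator_two_step:
  "mul (mul (mul x y) (- x)) (- y) = 2 *\<^sub>R b x y"
  using skew[of x y] by (simp add: bilinear_simps alternating scaleR_2)

lemma lie_group_two_step: "lie_group (two_step_group b)"
proof -
  have bb: "bounded_bilinear (\<lambda>p q. b (fst p) (snd q))"
    by (rule comp[OF bounded_linear_fst bounded_linear_snd])
  have "smooth_on (\<lambda>p. 0 + (fst p + snd p) + b (fst p) (snd p)) (UNIV :: ('e \<times> 'e) set)"
    by (rule smooth_on_quadratic[OF _ bb])
      (intro bounded_linear_add bounded_linear_fst bounded_linear_snd)
  then have "smooth_on (\<lambda>(x, y). x + y + b x y) UNIV"
    by (simp add: split_def)
  moreover have "smooth_on (\<lambda>x::'e. - x) UNIV"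
    using smooth_on_affine[OF bounded_linear_minus[OF bounded_linear_ident], of 0] by simp
  ultimately show ?thesis
    by (simp add: lie_group_def group_two_step smooth_manifold_euclidean smooth_map_prod_euclidean
        smooth_map_euclidean)
qed

text \<open>Commutators are the values of \<open>2 b\<close>, which \<open>b\<close> annihilates.
  This passes to the subgroup they generate, so all commutators with that subgroup are
  trivial.\<close>

lemma nilpotent_two_step: "nilpotent_group (two_step_group b)"
proof -
  let ?G = "two_step_group b"
  have central: "b k x = 0" if "k \<in> lower_central_series ?G 1" for k x
    using that[unfolded One_nat_def lower_central_series.simps(2)]
    by (induction rule: generate.induct)
      (auto simp: commutator_two_step bilinear_simps scaleR_left)
  have "{x \<otimes>\<^bsub>?G\<^esub> y \<otimes>\<^bsub>?G\<^esub> inv\<^bsub>?G\<^esub> x \<otimes>\<^bsub>?G\<^esub> inv\<^bsub>?G\<^esub> y} = {\<one>\<^bsub>?G\<^esub>}"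
    if "y \<in> lower_central_series ?G 1" for x y
    using central[OF that] skew[of x y] by (simp add: bilinear_simps alternating)
  moreover have "lower_central_series ?G 1 \<noteq> {}"
    by (auto intro: generate.one)
  ultimately have "lower_central_series ?G 2 = generate ?G {\<one>\<^bsub>?G\<^esub>}"
    unfolding numeral_2_eq_2 One_nat_def lower_central_series.simps(2)[of _ "Suc 0"]
    by (intro arg_cong[where f = "generate ?G"]) auto
  then show ?thesis
    using group.generate_one[OF group_two_step] group_two_step
    unfolding nilpotent_group_def by auto
qed

end

section \<open>Left-invariant geodesic orbit metrics\<close>

lemma has_vector_derivative_shift:
  fixes f :: "real \<Rightarrow> 'a::real_normed_vector"
  assumes "(f has_vector_derivative f') (at (t + r))"
  shows "((\<lambda>t. f (t + r)) has_vector_derivative f') (at t)"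
proof -
  have "((\<lambda>t. t + r) has_vector_derivative 1) (at t)"
    by (auto intro!: derivative_eq_intros)
  from vector_diff_chain_at[OF this assms] show ?thesis by (simp add: o_def)
qed

lemma zero_vector_derivative_imp_eq:
  fixes f :: "real \<Rightarrow> 'a::real_normed_vector"
  assumes "convex S" "s \<in> S" "t \<in> S" "\<And>t. t \<in> S \<Longrightarrow> (f has_vector_derivative 0) (at t)"
  shows "f t = f s"
proof -
  obtain c where "\<And>t. t \<in> S \<Longrightarrow> f t = c"
    using has_vector_derivative_zero_constant[OF assms(1), of f]
      has_vector_derivative_at_within[OF assms(4)] by blast
  then show ?thesis using assms(2,3) by simp
qed

text \<open>The left translation by the inverse of \<open>x\<close> has differential \<open>v \<mapsto> v - b x v\<close> at \<open>x\<close>.\<close>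

definition left_metric ::
  "('e \<Rightarrow> 'e \<Rightarrow> 'e) \<Rightarrow> ('e::euclidean_space \<Rightarrow> 'e \<Rightarrow> real) \<Rightarrow> ('e, 'e) metric_tensor" where
  "left_metric b ip c x v w = ip (v - b x v) (w - b x w)"

lemma preserves_left_metric_iff:
  assumes "\<And>x. (f has_derivative f' x) (at x)"
  shows "preserves_metric euclidean_manifold (left_metric b ip) f \<longleftrightarrow>
    (\<forall>x v w. ip (v - b x v) (w - b x w) =
       ip (f' x v - b (f x) (f' x v)) (f' x w - b (f x) (f' x w)))"
  using frechet_derivative_at[OF assms]
  by (simp add: preserves_metric_def left_metric_def)

text \<open>The Lie bracket is \<open>2 b\<close>, so \<open>D_geodesic\<close> is the geodesic orbit condition
  \<open>ip (D y y) w = ip y [y, w]\<close>; \<open>D_conserved\<close> makes \<open>D y\<close> constant along the solutions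
  of \<open>y' = D y y\<close>.\<close>

locale geodesic_orbit_bracket = two_step_bracket b + ip: bounded_bilinear ip + D: bounded_bilinear D
  for b :: "'e::euclidean_space \<Rightarrow> 'e \<Rightarrow> 'e" and ip :: "'e \<Rightarrow> 'e \<Rightarrow> real"
    and D :: "'e \<Rightarrow> 'e \<Rightarrow> 'e" +
  assumes ip_sym: "ip x y = ip y x"
    and ip_pos: "x \<noteq> 0 \<Longrightarrow> ip x x > 0"
    and D_skew: "ip (D y u) v + ip u (D y v) = 0"
    and D_derivation: "D y (b u v) = b (D y u) v + b u (D y v)"
    and D_conserved: "D (D x y) z = 0"
    and D_geodesic: "ip (D y y) w = 2 * ip y (b y w)"
    and D_flow: "\<exists>c. c 0 = x \<and> (\<forall>s. (c has_vector_derivative D y (c s)) (at s))"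
begin

section \<open>One-parameter groups of isometric automorphisms\<close>

lemma ip_zero_iff: "ip x x = 0 \<longleftrightarrow> x = 0"
  by (metis ip_pos ip.zero_left less_irrefl)

text \<open>Skew-symmetry of \<open>D y\<close> keeps the squared \<open>ip\<close>-norm of the
  difference of two solutions constant.\<close>

lemma D_flow_unique:
  assumes "convex S" "t0 \<in> S" "t \<in> S" "p t0 = q t0"
    and p: "\<And>t. t \<in> S \<Longrightarrow> (p has_vector_derivative D y (p t)) (at t)"
    and q: "\<And>t. t \<in> S \<Longrightarrow> (q has_vector_derivative D y (q t)) (at t)"
  shows "p t = q t"
proof -
  have "((\<lambda>t. ip (p t - q t) (p t - q t)) has_vector_derivative 0) (at t)" if "t \<in> S" for t
  proof -
    have "((\<lambda>t. p t - q t) has_vector_derivative D y (p t - q t)) (at t)"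
      using has_vector_derivative_diff[OF p[OF that] q[OF that]] by (simp add: D.diff_right)
    from ip.has_vector_derivative[OF this this] show ?thesis
      using D_skew[of y "p t - q t" "p t - q t"]
      by (simp add: add.commute)
  qed
  from zero_vector_derivative_imp_eq[OF assms(1-3) this] assms(4)
  have "ip (p t - q t) (p t - q t) = 0"
    by (simp add: ip.zero_left)
  then show ?thesis by (simp add: ip_zero_iff)
qed

text \<open>This is the operator exponential of \<open>s\<close> times \<open>D y\<close>, picked by
  choice among the solutions that \<open>D_flow\<close> provides.\<close>

definition flow :: "'e \<Rightarrow> real \<Rightarrow> 'e \<Rightarrow> 'e" where
  "flow y s x = (SOME c. c 0 = x \<and> (\<forall>s. (c has_vector_derivative D y (c s)) (at s))) s"

lemma flow_0 [simp]: "flow y 0 x = x"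
  and flow_deriv: "((\<lambda>s. flow y s x) has_vector_derivative D y (flow y s x)) (at s)"
proof -
  have *: "flow y 0 x = x \<and> (\<forall>s. ((\<lambda>s. flow y s x) has_vector_derivative D y (flow y s x)) (at s))"
    unfolding flow_def using someI_ex[OF D_flow[of x y]] by simp
  show "flow y 0 x = x" using * by blast
  show "((\<lambda>s. flow y s x) has_vector_derivative D y (flow y s x)) (at s)" using * by blast
qed

text \<open>The source of most identities for \<open>flow\<close>: show that one side solves the
  equation and compare initial values.\<close>

lemma flow_unique:
  assumes "\<And>s. (c has_vector_derivative D y (c s)) (at s)"
  shows "c s = flow y s (c 0)"
  by (rule D_flow_unique[of UNIV 0 s c "\<lambda>s. flow y s (c 0)" y]) (auto simp: assms flow_deriv)

lemma flow_plus: "flow y (s + r) x = flow y s (flow y r x)"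
proof -
  have "((\<lambda>s. flow y (s + r) x) has_vector_derivative D y (flow y (s + r) x)) (at s)" for s
    by (rule has_vector_derivative_shift[OF flow_deriv])
  from flow_unique[OF this, of s] show ?thesis by simp
qed

lemma linear_flow: "linear (flow y s)"
proof (rule linearI)
  fix u v :: 'e and r :: real
  have "((\<lambda>s. flow y s u + flow y s v) has_vector_derivative
      D y (flow y s u + flow y s v)) (at s)" for s
    using has_vector_derivative_add[OF flow_deriv flow_deriv] by (simp add: D.add_right)
  from flow_unique[OF this, of s] show "flow y s (u + v) = flow y s u + flow y s v" by simp
  have "((\<lambda>s. r *\<^sub>R flow y s u) has_vector_derivative D y (r *\<^sub>R flow y s u)) (at s)" for s
    using bounded_linear.has_vector_derivative[OF bounded_linear_scaleR_right flow_deriv]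
    by (simp add: D.scaleR_right)
  from flow_unique[OF this, of s] show "flow y s (r *\<^sub>R u) = r *\<^sub>R flow y s u" by simp
qed

lemmas bounded_linear_flow = linear_flow[unfolded linear_conv_bounded_linear]
lemmas flow_add = linear_add[OF linear_flow]
lemmas flow_diff = linear_diff[OF linear_flow]

text \<open>A derivation exponentiates to automorphisms: by the Leibniz rule the right-hand side
  solves the flow equation.\<close>

lemma flow_b: "flow y s (b u v) = b (flow y s u) (flow y s v)"
proof -
  have "((\<lambda>s. b (flow y s u) (flow y s v)) has_vector_derivative
      D y (b (flow y s u) (flow y s v))) (at s)" for s
    using has_vector_derivative[OF flow_deriv flow_deriv]
    by (simp add: D_derivation add.commute)
  from flow_unique[OF this, of s] show ?thesis by simp
qed

text \<open>A skew-symmetric map exponentiates to orthogonal maps.\<close>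

lemma flow_ip: "ip (flow y s u) (flow y s v) = ip u v"
proof -
  have "((\<lambda>s. ip (flow y s u) (flow y s v)) has_vector_derivative 0) (at s)" for s
    using ip.has_vector_derivative[OF flow_deriv[of y u s] flow_deriv[of y v s]]
      D_skew[of y "flow y s u" "flow y s v"] by (simp add: add.commute)
  then show ?thesis
    using zero_vector_derivative_imp_eq[of UNIV 0 s "\<lambda>s. ip (flow y s u) (flow y s v)"] by simp
qed

lemma continuous_on_flow: "continuous_on S (\<lambda>s. flow y s x)"
  using flow_deriv by (meson continuous_at_imp_continuous_on has_vector_derivative_continuous)

text \<open>Linearity in \<open>x\<close> reduces joint continuity to the finitely many curves
  through basis vectors.\<close>

lemma continuous_on_flow_joint: "continuous_on S (\<lambda>(s, x). flow y s x)"
proof -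
  have flow_sum: "flow y s x = (\<Sum>i\<in>Basis. (x \<bullet> i) *\<^sub>R flow y s i)" for s x
  proof -
    have "flow y s x = flow y s (\<Sum>i\<in>Basis. (x \<bullet> i) *\<^sub>R i)"
      by (simp add: euclidean_representation)
    also have "\<dots> = (\<Sum>i\<in>Basis. (x \<bullet> i) *\<^sub>R flow y s i)"
      by (simp only: linear_sum[OF linear_flow] linear_cmul[OF linear_flow])
    finally show ?thesis .
  qed
  have "(\<lambda>(s, x). flow y s x) =
      (\<lambda>p. \<Sum>i\<in>Basis. (snd p \<bullet> i) *\<^sub>R flow y (fst p) i)"
    unfolding split_def by (rule ext) (rule flow_sum)
  moreover have "continuous_on S (\<lambda>p. flow y (fst p) i)" for i
    by (rule continuous_on_compose2[OF continuous_on_flow[of UNIV]]) (auto intro: continuous_intros)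
  ultimately show ?thesis
    by (simp add: continuous_intros)
qed

text \<open>A curve is determined by an initial value and its velocity \<open>y\<close> translated to the identity:
  the difference of two such curves has central, hence vanishing, derivative.\<close>

lemma curve_unique:
  assumes S: "convex S" "t0 \<in> S" "t \<in> S" and eq: "p t0 = q t0"
    and p: "\<And>t. t \<in> S \<Longrightarrow> (p has_vector_derivative y t + b (p t) (y t)) (at t)"
    and q: "\<And>t. t \<in> S \<Longrightarrow> (q has_vector_derivative y t + b (q t) (y t)) (at t)"
  shows "p t = q t"
proof -
  have d: "((\<lambda>t. p t - q t) has_vector_derivative b (p t - q t) (y t)) (at t)" if "t \<in> S" for t
    using has_vector_derivative_diff[OF p[OF that] q[OF that]] by (simp add: diff_left)
  have "b (p t - q t) w = 0" if "t \<in> S" for t w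
  proof -
    have "((\<lambda>t. b (p t - q t) w) has_vector_derivative 0) (at t)" if "t \<in> S" for t
      using bounded_linear.has_vector_derivative[OF bounded_linear_left d[OF that], of w] by simp
    from zero_vector_derivative_imp_eq[OF S(1,2) that this] show ?thesis
      using eq by (simp add: zero_left)
  qed
  with d have "((\<lambda>t. p t - q t) has_vector_derivative 0) (at t)" if "t \<in> S" for t
    using that by fastforce
  from zero_vector_derivative_imp_eq[OF S this] show ?thesis using eq by simp
qed

text \<open>Left translation does not change the velocity translated back to the identity.\<close>

lemma mul_deriv:
  assumes "(h has_vector_derivative v + b (h t) v) (at t)"
  shows "((\<lambda>t. mul a (h t)) has_vector_derivative v + b (mul a (h t)) v) (at t)"
  using has_vector_derivative_add[OF has_vector_derivative_add[OF has_vector_derivative_const assms]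
      bounded_linear.has_vector_derivative[OF bounded_linear_right assms]]
  by (simp add: bilinear_simps algebra_simps)

text \<open>Two integrations suffice: \<open>e\<close> integrates the prescribed velocity, and
  \<open>c\<close> integrates the correction \<open>b (e t) (flow y t y)\<close>. Since
  \<open>c\<close> is central, it causes no further correction.\<close>

lemma ex_horizontal_curve:
  "\<exists>h. h 0 = 0 \<and> (\<forall>t. (h has_vector_derivative flow y t y + b (h t) (flow y t y)) (at t))"
proof -
  have antiderivative: "\<exists>F. F 0 = 0 \<and> (\<forall>t. (F has_vector_derivative f t) (at t))"
    if "continuous_on UNIV f" for f :: "real \<Rightarrow> 'e"
  proof -
    have "isCont f t" for t
      using that by (simp add: continuous_on_eq_continuous_at)
    then obtain F where F: "\<And>t. (F has_vector_derivative f t) (at t)"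
      using einterval_antiderivative[of "-\<infinity>" "\<infinity>" f] by auto
    then have "((\<lambda>t. F t - F 0) has_vector_derivative f t) (at t)" for t
      using has_vector_derivative_diff[OF F has_vector_derivative_const] by simp
    then show ?thesis by (intro exI[of _ "\<lambda>t. F t - F 0"]) auto
  qed
  let ?y = "\<lambda>t. flow y t y"
  obtain e where e: "e 0 = 0" "\<And>t. (e has_vector_derivative ?y t) (at t)"
    using antiderivative[OF continuous_on_flow] by blast
  have "continuous_on UNIV e"
    using e(2) by (meson continuous_at_imp_continuous_on has_vector_derivative_continuous)
  then have "continuous_on UNIV (\<lambda>t. b (e t) (?y t))"
    by (intro continuous_on continuous_on_flow)
  from antiderivative[OF this] obtain c where
    c: "c 0 = 0" "\<And>t. (c has_vector_derivative b (e t) (?y t)) (at t)"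
    by blast
  have central: "b (c t) w = 0" for t w
  proof -
    have "((\<lambda>t. b (c t) w) has_vector_derivative 0) (at t)" for t
      using bounded_linear.has_vector_derivative[OF bounded_linear_left[of w] c(2)[of t]] by simp
    from zero_vector_derivative_imp_eq[of UNIV 0 t, OF _ _ _ this] show ?thesis
      using c(1) by (simp add: zero_left)
  qed
  have "((\<lambda>t. e t + c t) has_vector_derivative ?y t + b (e t + c t) (?y t)) (at t)" for t
    using has_vector_derivative_add[OF e(2) c(2)] by (simp add: add_left central)
  then show ?thesis
    using e(1) c(1) by (intro exI[of _ "\<lambda>t. e t + c t"]) simp
qed

definition horizontal :: "'e \<Rightarrow> real \<Rightarrow> 'e" where
  "horizontal y =
    (SOME h. h 0 = 0 \<and> (\<forall>t. (h has_vector_derivative flow y t y + b (h t) (flow y t y)) (at t)))"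

lemma horizontal_0 [simp]: "horizontal y 0 = 0"
  and horizontal_deriv: "(horizontal y has_vector_derivative
    flow y t y + b (horizontal y t) (flow y t y)) (at t)"
  unfolding horizontal_def using someI_ex[OF ex_horizontal_curve[of y]] by auto

text \<open>The cocycle identity that makes the pairs of \<open>horizontal y s\<close> and
  \<open>flow y s\<close> a one-parameter subgroup of the semidirect product. As curves in
  \<open>r\<close>, both sides have the velocity \<open>flow y (s + r) y\<close> translated to the
  identity and agree at \<open>r = 0\<close>.\<close>

lemma horizontal_plus:
  "horizontal y (s + r) = mul (horizontal y s) (flow y s (horizontal y r))"
proof -
  have "((\<lambda>r. horizontal y (s + r)) has_vector_derivative
      flow y (s + r) y + b (horizontal y (s + r)) (flow y (s + r) y)) (at r)" for r
    using has_vector_derivative_shift[OF horizontal_deriv[of y "r + s"]]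
    by (simp add: add.commute)
  moreover have "((\<lambda>r. flow y s (horizontal y r)) has_vector_derivative
      flow y (s + r) y + b (flow y s (horizontal y r)) (flow y (s + r) y)) (at r)" for r
    using bounded_linear.has_vector_derivative[OF bounded_linear_flow horizontal_deriv]
    by (simp add: flow_add flow_b flow_plus)
  then have "((\<lambda>r. mul (horizontal y s) (flow y s (horizontal y r))) has_vector_derivative
      flow y (s + r) y + b (mul (horizontal y s) (flow y s (horizontal y r))) (flow y (s + r) y))
      (at r)" for r
    by (rule mul_deriv)
  ultimately show ?thesis
    by (intro curve_unique[of UNIV 0 r "\<lambda>r. horizontal y (s + r)" _ "\<lambda>r. flow y (s + r) y"])
      (auto simp: linear_0[OF linear_flow] bilinear_simps)
qed

text \<open>\<open>orbit_map a y\<close> is a one-parameter group of the semidirect product of the group with its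
  isometric automorphisms, conjugated by the left translation by \<open>a\<close>.\<close>

definition orbit_map :: "'e \<Rightarrow> 'e \<Rightarrow> real \<Rightarrow> 'e \<Rightarrow> 'e" where
  "orbit_map a y s x = mul (mul a (horizontal y s)) (flow y s (mul (- a) x))"

lemma orbit_map_base: "orbit_map a y s a = mul a (horizontal y s)"
  by (simp only: orbit_map_def mul_minus_left linear_0[OF linear_flow] zero_right add_0_right)

lemma orbit_map_0: "orbit_map a y 0 x = x"
  by (simp add: orbit_map_def bilinear_simps alternating)

lemma orbit_map_plus: "orbit_map a y (s + r) x = orbit_map a y s (orbit_map a y r x)"
proof -
  have mul_cancel: "mul (- a) (mul a z) = z" for z
    by (simp add: bilinear_simps alternating)
  have flow_mul: "flow y s (mul u v) = mul (flow y s u) (flow y s v)" for u v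
    by (simp only: flow_add flow_b)
  show ?thesis
    by (simp only: orbit_map_def horizontal_plus mul_assoc mul_cancel flow_mul flow_plus)
qed

text \<open>Affinity gives smoothness. The last conjunct says that the differential, read through
  left translations to the identity, is \<open>flow y s\<close>, so the map is isometric by
  \<open>flow_ip\<close>.\<close>

lemma orbit_map_affine:
  "\<exists>k A. bounded_linear A \<and> orbit_map a y s = (\<lambda>x. k + A x) \<and>
    (\<forall>x v. A v - b (k + A x) (A v) = flow y s (v - b x v))"
proof -
  let ?m = "mul a (horizontal y s)"
  let ?A = "\<lambda>x. flow y s (x - b a x) + b ?m (flow y s (x - b a x))"
  let ?k = "?m + flow y s (- a) + b ?m (flow y s (- a))"
  have "bounded_linear (\<lambda>x. flow y s (x - b a x))"
    by (intro bounded_linear_compose[OF bounded_linear_flow] bounded_linear_sub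
        bounded_linear_ident bounded_linear_right)
  then have "bounded_linear ?A"
    by (intro bounded_linear_add bounded_linear_compose[OF bounded_linear_right])
  moreover have "orbit_map a y s = (\<lambda>x. ?k + ?A x)"
    by (simp add: fun_eq_iff orbit_map_def bilinear_simps flow_add flow_diff flow_b
        linear_neg[OF linear_flow])
  moreover have "?A v - b (?k + ?A x) (?A v) = flow y s (v - b x v)" for x v
    by (simp add: bilinear_simps flow_add flow_diff flow_b linear_neg[OF linear_flow])
  ultimately show ?thesis by blast
qed

abbreviation "mtensor \<equiv> left_metric b ip"

lemma smooth_orbit_map: "smooth_on (orbit_map a y s) UNIV"
  using orbit_map_affine[of a y s] smooth_on_affine by metis

lemma isometry_orbit_map: "isometry euclidean_manifold mtensor (orbit_map a y s)"
proof -
  obtain k A where A: "bounded_linear A" "orbit_map a y s = (\<lambda>x. k + A x)"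
    "\<And>x v. A v - b (k + A x) (A v) = flow y s (v - b x v)"
    using orbit_map_affine by metis
  have inverse: "orbit_map a y s (orbit_map a y (- s) x) = x"
    "orbit_map a y (- s) (orbit_map a y s x) = x" for x
    by (simp_all add: orbit_map_plus[symmetric] orbit_map_0)
  then have "bij (orbit_map a y s)"
    by (intro bijI') metis+
  moreover have "inv_into UNIV (orbit_map a y s) = orbit_map a y (- s)"
    using inverse by (intro inv_equality) auto
  moreover have "preserves_metric euclidean_manifold mtensor (orbit_map a y s)"
  proof -
    have "((\<lambda>x. k + A x) has_derivative A) (at x)" for x
      by (auto intro!: derivative_eq_intros bounded_linear_imp_has_derivative A(1))
    then show ?thesis
      unfolding A(2) by (subst preserves_left_metric_iff) (auto simp: A(3) flow_ip)
  qed
  ultimately show ?thesis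
    by (simp add: isometry_def diffeomorphism_def smooth_map_euclidean smooth_orbit_map)
qed

lemma one_parameter_orbit_map:
  "one_parameter_isometry_group euclidean_manifold mtensor (orbit_map a y)"
proof -
  have h: "continuous_on UNIV (horizontal y)"
    using horizontal_deriv
    by (meson continuous_at_imp_continuous_on has_vector_derivative_continuous)
  have "continuous_on UNIV (\<lambda>p. (fst p, mul (- a) (snd p)))"
    by (intro continuous_intros continuous_on)
  from continuous_on_compose2[OF continuous_on_flow_joint[of UNIV y] this]
  have "continuous_on UNIV (\<lambda>p. flow y (fst p) (mul (- a) (snd p)))"
    by simp
  then have "continuous_on UNIV (\<lambda>(s, x). orbit_map a y s x)"
    unfolding orbit_map_def split_def
    by (intro continuous_intros continuous_on continuous_on_compose2[OF h]) auto
  then show ?thesis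
    by (simp add: one_parameter_isometry_group_def isometry_orbit_map orbit_map_plus)
qed

section \<open>The metric tensor and its geodesics\<close>

lemma riemannian_metric: "riemannian_metric euclidean_manifold mtensor"
proof -
  have "bilinear (mtensor c x)" for c x
  proof -
    have "bounded_linear (\<lambda>v. v - b x v)"
      by (intro bounded_linear_sub bounded_linear_ident bounded_linear_right)
    from ip.comp[OF this this] show ?thesis
      by (simp add: left_metric_def[abs_def] bilinear_conv_bounded_bilinear)
  qed
  moreover have "mtensor c x v v > 0" if "v \<noteq> 0" for c x v
  proof -
    have "v - b x v \<noteq> 0"
    proof
      assume "v - b x v = 0"
      then have "v = b x v" by simp
      then have "v = b x (b x v)" by metis
      with that show False by simp
    qed
    then show ?thesis by (simp add: left_metric_def ip_pos)
  qed
  moreover have "smooth_on (\<lambda>x. mtensor c x v w) UNIV" for c v w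
  proof -
    have bilin: "bounded_bilinear (\<lambda>x x'. ip (b x v) (b x' w))"
      by (rule ip.comp[OF bounded_linear_left bounded_linear_left])
    have lin: "bounded_linear (\<lambda>x. - ip (b x v) w - ip v (b x w))"
      by (intro bounded_linear_sub bounded_linear_minus
          bounded_linear_compose[OF ip.bounded_linear_left]
          bounded_linear_compose[OF ip.bounded_linear_right] bounded_linear_left)
    \<comment> \<open>Expanding the product of the two affine factors gives a quadratic polynomial
      in \<open>x\<close>.\<close>
    from smooth_on_quadratic[OF lin bilin, of "ip v w" UNIV] show ?thesis
      by (simp add: left_metric_def ip.diff_left ip.diff_right algebra_simps)
  qed
  moreover have "preserves_metric euclidean_manifold mtensor (\<lambda>x. x)"
    by (subst preserves_left_metric_iff[where f' = "\<lambda>x v. v"]) auto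
  ultimately show ?thesis
    by (simp add: riemannian_metric_def) (simp add: left_metric_def ip_sym)
qed

lemma left_invariant_metric: "left_invariant_metric (two_step_group b) mtensor"
proof -
  have "preserves_metric euclidean_manifold mtensor (\<lambda>x. mul a x)" for a
  proof -
    have "((\<lambda>x. mul a x) has_derivative (\<lambda>v. v + b a v)) (at x)" for x
      by (auto intro!: derivative_eq_intros
          bounded_linear_imp_has_derivative[OF bounded_linear_right])
    then show ?thesis
      by (subst preserves_left_metric_iff) (auto simp: bilinear_simps)
  qed
  then show ?thesis
    by (simp add: left_invariant_metric_def riemannian_metric)
qed

text \<open>The metric depends on \<open>x\<close> only through \<open>v - b x v\<close>, whose
  derivative along \<open>d\<close> is \<open>- b d v\<close>. The terms containing
  \<open>b v v\<close> vanish and the remaining ones coincide.\<close>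

lemma christoffel_metric:
  "christoffel (mtensor c) x v v z = - 2 * ip (v - b x v) (b v z)"
proof -
  have "((\<lambda>x. mtensor c x u w) has_derivative
      (\<lambda>d. - ip (b d u) (w - b x w) - ip (u - b x u) (b d w))) (at x)" for u w
  proof -
    have "((\<lambda>x. u - b x u) has_derivative (\<lambda>d. - b d u)) (at x)" for u
      by (auto intro!: derivative_eq_intros
          bounded_linear_imp_has_derivative[OF bounded_linear_left])
    from ip.FDERIV[OF this this, of u w] show ?thesis
      by (simp add: left_metric_def[abs_def] ip.minus_left ip.minus_right algebra_simps)
  qed
  then have "frechet_derivative (\<lambda>x. mtensor c x u w) (at x) =
      (\<lambda>d. - ip (b d u) (w - b x w) - ip (u - b x u) (b d w))" for u w
    by (rule frechet_derivative_at[symmetric])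
  then show ?thesis
    using skew[of z v]
    by (simp add: christoffel_def alternating ip.zero_left ip.minus_left ip.minus_right
        ip_sym[of "b v z" "v - b x v"])
qed

text \<open>The velocity \<open>y\<close> translated to the identity satisfies \<open>y' = D y y\<close>. Since \<open>D y\<close> is constant
  along the solutions, this equation is in fact linear with constant coefficients.\<close>

lemma geodesic_orbit: "geodesic_orbit_metric euclidean_manifold mtensor"
  unfolding geodesic_orbit_metric_def
proof (intro conjI allI impI riemannian_metric)
  fix S :: "real set" and \<gamma> :: "real \<Rightarrow> 'e"
  assume geo: "geodesic_on euclidean_manifold mtensor S \<gamma>"
  show "\<exists>\<phi>. one_parameter_isometry_group euclidean_manifold mtensor \<phi> \<and>
      (\<exists>p\<in>topspace (mtop euclidean_manifold). \<forall>t\<in>S. \<gamma> t = \<phi> t p)"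
  proof (cases "S = {}")
    case True
    then show ?thesis using one_parameter_orbit_map by auto
  next
    case False
    then obtain t0 where t0: "t0 \<in> S" by blast
    have S: "open S" "convex S"
      using geo by (auto simp: geodesic_on_def is_interval_convex)
    obtain x' x'' where x: "\<And>t. t \<in> S \<Longrightarrow> (\<gamma> has_vector_derivative x' t) (at t)"
      "\<And>t. t \<in> S \<Longrightarrow> (x' has_vector_derivative x'' t) (at t)"
      and eq: "\<And>t z. t \<in> S \<Longrightarrow> mtensor (UNIV, \<lambda>x. x) (\<gamma> t) (x'' t) z +
        christoffel (mtensor (UNIV, \<lambda>x. x)) (\<gamma> t) (x' t) (x' t) z = 0"
    proof -
      have "\<exists>x' x''. \<forall>t\<in>S. (\<gamma> has_vector_derivative x' t) (at t) \<and>
          (x' has_vector_derivative x'' t) (at t) \<and>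
          (\<forall>z. mtensor (UNIV, \<lambda>x. x) (\<gamma> t) (x'' t) z +
            christoffel (mtensor (UNIV, \<lambda>x. x)) (\<gamma> t) (x' t) (x' t) z = 0)"
        using geo S(1) by (simp add: geodesic_on_def o_def)
      then show ?thesis using that by blast
    qed
    define y where "y t = x' t - b (\<gamma> t) (x' t)" for t
    have y: "(y has_vector_derivative x'' t - b (\<gamma> t) (x'' t)) (at t)" if "t \<in> S" for t
      unfolding y_def
      using has_vector_derivative_diff[OF x(2)[OF that]
          has_vector_derivative[OF x(1)[OF that] x(2)[OF that]]]
      by (simp add: alternating)
    have euler: "x'' t - b (\<gamma> t) (x'' t) = D (y t) (y t)" (is "?l = ?r") if "t \<in> S" for t
    proof -
      have "ip ?l w = ip ?r w" for w
        \<comment> \<open>This test vector is the left translate of \<open>w\<close> to the point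
          \<open>\<gamma> t\<close>; translating it back returns \<open>w\<close>.\<close>
        using eq[OF that, of "w + b (\<gamma> t) w"]
        by (simp add: D_geodesic christoffel_metric left_metric_def y_def bilinear_simps)
      then have "ip (?l - ?r) (?l - ?r) = 0" by (simp add: ip.diff_left)
      then show ?thesis by (simp add: ip_zero_iff)
    qed
    define Y where "Y = y t0"
    have D_const: "D (y t) w = D Y w" if "t \<in> S" for t w
    proof -
      have "((\<lambda>t. D (y t) w) has_vector_derivative 0) (at t)" if "t \<in> S" for t
        using bounded_linear.has_vector_derivative[OF D.bounded_linear_left y[OF that], of w]
        by (simp add: euler[OF that] D_conserved)
      from zero_vector_derivative_imp_eq[OF S(2) t0 that this] show ?thesis
        by (simp add: Y_def)
    qed
    have shift: "((\<lambda>t. f (t - t0)) has_vector_derivative f' (t - t0)) (at t)"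
      if "\<And>t. (f has_vector_derivative f' t) (at t)" for f f' :: "real \<Rightarrow> 'e" and t
      using has_vector_derivative_shift[of f _ t "- t0", OF that] by simp
    have y_flow: "y t = flow Y (t - t0) Y" if "t \<in> S" for t
    proof (rule D_flow_unique[OF S(2) t0 that])
      show "(y has_vector_derivative D Y (y t)) (at t)" if "t \<in> S" for t
        using y[OF that] by (simp add: euler[OF that] D_const[OF that])
      show "((\<lambda>t. flow Y (t - t0) Y) has_vector_derivative D Y (flow Y (t - t0) Y)) (at t)" for t
        by (rule shift[OF flow_deriv])
    qed (simp add: Y_def)
    let ?a = "\<gamma> t0"
    have "\<gamma> t = mul ?a (horizontal Y (t - t0))" if "t \<in> S" for t
    proof (rule curve_unique[OF S(2) t0 that, of _ _ y])
      show "(\<gamma> has_vector_derivative y t + b (\<gamma> t) (y t)) (at t)" if "t \<in> S" for t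
        using x(1)[OF that] by (simp add: y_def diff_right)
      show "((\<lambda>t. mul ?a (horizontal Y (t - t0))) has_vector_derivative
          y t + b (mul ?a (horizontal Y (t - t0))) (y t)) (at t)" if "t \<in> S" for t
        unfolding y_flow[OF that]
        by (rule mul_deriv) (rule shift[OF horizontal_deriv])
    qed (simp add: zero_right)
    \<comment> \<open>The orbit through \<open>?a\<close> passes it at time 0, the geodesic at time
      \<open>t0\<close>; moving the base point back by \<open>t0\<close> aligns them.\<close>
    then have "\<gamma> t = orbit_map ?a Y t (orbit_map ?a Y (- t0) ?a)" if "t \<in> S" for t
      using that orbit_map_base[of ?a Y "t + - t0"] orbit_map_plus[of ?a Y t "- t0" ?a] by simp
    then show ?thesis using one_parameter_orbit_map by auto
  qed
qed

end

section \<open>The ten-dimensional family\<close>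

lemma exhaust_10: "x = 1 \<or> x = 2 \<or> x = 3 \<or> x = 4 \<or> x = 5 \<or> x = 6 \<or> x = 7 \<or> x = 8 \<or> x = 9 \<or> x = 10"
  for x :: 10
proof (induct x)
  case (of_int z)
  then have "0 \<le> z" "z < 10" by simp_all
  then have "z = 0 \<or> z = 1 \<or> z = 2 \<or> z = 3 \<or> z = 4 \<or> z = 5 \<or> z = 6 \<or> z = 7 \<or> z = 8 \<or> z = 9"
    by arith
  then show ?case by auto
qed

lemma forall_10: "(\<forall>i::10. P i) \<longleftrightarrow>
    P 1 \<and> P 2 \<and> P 3 \<and> P 4 \<and> P 5 \<and> P 6 \<and> P 7 \<and> P 8 \<and> P 9 \<and> P 10"
  using exhaust_10 by metis

definition area :: "10 \<Rightarrow> 10 \<Rightarrow> real ^ 10 \<Rightarrow> real ^ 10 \<Rightarrow> real" where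
  "area i j x y = x $ i * y $ j - x $ j * y $ i"

definition central :: "real \<Rightarrow> real \<Rightarrow> real ^ 10" where
  "central u v = u *\<^sub>R axis 9 1 + v *\<^sub>R axis 10 1"

text \<open>The group is the quotient of the product of four Heisenberg groups by a plane in its centre:
  the four centres become the lines spanned by \<open>(1, 0)\<close>, \<open>(0, 1)\<close>, \<open>(1, 1)\<close>, \<open>(1, t)\<close>.\<close>

definition bracket :: "real \<Rightarrow> real ^ 10 \<Rightarrow> real ^ 10 \<Rightarrow> real ^ 10" where
  "bracket t x y = central (area 1 2 x y + area 5 6 x y + area 7 8 x y)
     (area 3 4 x y + area 5 6 x y + t * area 7 8 x y)"

text \<open>The scales of the fourth plane and of the centre are fixed to 1, which leaves three
  parameters.\<close>

definition block_ip :: "real ^ 3 \<Rightarrow> real ^ 10 \<Rightarrow> real ^ 10 \<Rightarrow> real" where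
  "block_ip a x y = a $ 1 * (x $ 1 * y $ 1 + x $ 2 * y $ 2) + a $ 2 * (x $ 3 * y $ 3 + x $ 4 * y $ 4) +
     a $ 3 * (x $ 5 * y $ 5 + x $ 6 * y $ 6) + (x $ 7 * y $ 7 + x $ 8 * y $ 8) +
     x $ 9 * y $ 9 + x $ 10 * y $ 10"

definition quarter_turn :: "10 \<Rightarrow> 10 \<Rightarrow> real ^ 10 \<Rightarrow> real ^ 10" where
  "quarter_turn i j x = x $ i *\<^sub>R axis j 1 - x $ j *\<^sub>R axis i 1"

text \<open>The map \<open>J\<close> for the central part of \<open>y\<close>. Each angular velocity
  is the inner product of that part with the vector of the plane, divided by the scale of the plane;
  the factor 2 appears because the Lie bracket is twice \<open>bracket t\<close>.\<close>

definition block_rotation :: "real \<Rightarrow> real ^ 3 \<Rightarrow> real ^ 10 \<Rightarrow> real ^ 10 \<Rightarrow> real ^ 10" where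
  "block_rotation t a y x =
     (2 * y $ 9 / a $ 1) *\<^sub>R quarter_turn 1 2 x + (2 * y $ 10 / a $ 2) *\<^sub>R quarter_turn 3 4 x +
     (2 * (y $ 9 + y $ 10) / a $ 3) *\<^sub>R quarter_turn 5 6 x +
     (2 * (y $ 9 + t * y $ 10)) *\<^sub>R quarter_turn 7 8 x"

section \<open>Verification of the geodesic orbit conditions\<close>

lemma axis_component: "axis i (1::real) $ j = (if j = i then 1 else 0)"
  by (simp add: axis_def)

lemma central_component:
  "central u v $ i = (if i = 9 then u else if i = 10 then v else 0)"
  by (simp add: central_def axis_component)

lemma central_inject: "central u v = central u' v' \<longleftrightarrow> u = u' \<and> v = v'"
  by (simp add: vec_eq_iff forall_10 central_component)

lemma scaleR_central: "r *\<^sub>R central u v = central (r * u) (r * v)"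
  by (simp add: central_def scaleR_add_right)

lemma central_add: "central u v + central u' v' = central (u + u') (v + v')"
  by (simp add: central_def scaleR_add_left)

lemma bounded_bilinear_bracket: "bounded_bilinear (bracket t)"
  unfolding bilinear_conv_bounded_bilinear[symmetric]
  by (auto simp: bilinear_def linear_iff bracket_def area_def vec_eq_iff central_component
      algebra_simps)

lemma bounded_bilinear_block_ip: "bounded_bilinear (block_ip a)"
  unfolding bilinear_conv_bounded_bilinear[symmetric]
  by (auto simp: bilinear_def linear_iff block_ip_def algebra_simps)

lemma quarter_turn_add: "quarter_turn i j (x + y) = quarter_turn i j x + quarter_turn i j y"
  and quarter_turn_scaleR: "quarter_turn i j (r *\<^sub>R x) = r *\<^sub>R quarter_turn i j x"
  by (simp_all add: quarter_turn_def algebra_simps)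

lemma bounded_bilinear_block_rotation: "bounded_bilinear (block_rotation t a)"
  unfolding bilinear_conv_bounded_bilinear[symmetric]
  by (auto simp: bilinear_def linear_iff block_rotation_def quarter_turn_add quarter_turn_scaleR
      algebra_simps add_divide_distrib)

interpretation two_step_bracket "bracket t" for t
  by (intro two_step_bracket.intro bounded_bilinear_bracket two_step_bracket_axioms.intro)
    (simp_all add: bracket_def area_def vec_eq_iff central_component)

lemma block_rotation_component:
  "block_rotation t a y x $ 1 = - (2 * y $ 9 / a $ 1 * x $ 2)"
  "block_rotation t a y x $ 2 = 2 * y $ 9 / a $ 1 * x $ 1"
  "block_rotation t a y x $ 3 = - (2 * y $ 10 / a $ 2 * x $ 4)"
  "block_rotation t a y x $ 4 = 2 * y $ 10 / a $ 2 * x $ 3"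
  "block_rotation t a y x $ 5 = - (2 * (y $ 9 + y $ 10) / a $ 3 * x $ 6)"
  "block_rotation t a y x $ 6 = 2 * (y $ 9 + y $ 10) / a $ 3 * x $ 5"
  "block_rotation t a y x $ 7 = - (2 * (y $ 9 + t * y $ 10) * x $ 8)"
  "block_rotation t a y x $ 8 = 2 * (y $ 9 + t * y $ 10) * x $ 7"
  "block_rotation t a y x $ 9 = 0"
  "block_rotation t a y x $ 10 = 0"
  by (simp_all add: block_rotation_def quarter_turn_def axis_component)

definition rotating :: "10 \<Rightarrow> 10 \<Rightarrow> real \<Rightarrow> real ^ 10 \<Rightarrow> real \<Rightarrow> real ^ 10" where
  "rotating i j \<theta> x s = (x $ i * cos (\<theta> * s) - x $ j * sin (\<theta> * s)) *\<^sub>R axis i 1 +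
     (x $ j * cos (\<theta> * s) + x $ i * sin (\<theta> * s)) *\<^sub>R axis j 1"

lemma rotating_deriv:
  assumes "i \<noteq> j"
  shows "(rotating i j \<theta> x has_vector_derivative \<theta> *\<^sub>R quarter_turn i j (rotating i j \<theta> x s)) (at s)"
proof -
  have "((\<lambda>s. x $ i * cos (\<theta> * s) - x $ j * sin (\<theta> * s)) has_real_derivative
      - \<theta> * (x $ j * cos (\<theta> * s) + x $ i * sin (\<theta> * s))) (at s)"
    by (auto intro!: derivative_eq_intros simp: algebra_simps)
  moreover have "((\<lambda>s. x $ j * cos (\<theta> * s) + x $ i * sin (\<theta> * s)) has_real_derivative
      \<theta> * (x $ i * cos (\<theta> * s) - x $ j * sin (\<theta> * s))) (at s)"
    by (auto intro!: derivative_eq_intros simp: algebra_simps)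
  ultimately have "(rotating i j \<theta> x has_vector_derivative
      (\<theta> * (x $ i * cos (\<theta> * s) - x $ j * sin (\<theta> * s))) *\<^sub>R axis j 1 -
      (\<theta> * (x $ j * cos (\<theta> * s) + x $ i * sin (\<theta> * s))) *\<^sub>R axis i 1) (at s)"
    unfolding rotating_def[abs_def]
    using has_vector_derivative_add[OF has_vector_derivative_scaleR[OF _ has_vector_derivative_const]
        has_vector_derivative_scaleR[OF _ has_vector_derivative_const]] by fastforce
  then show ?thesis
    using assms by (simp add: quarter_turn_def rotating_def axis_component scaleR_diff_right)
qed

lemma quarter_turn_rotating_disjoint:
  assumes "i \<noteq> k" "i \<noteq> l" "j \<noteq> k" "j \<noteq> l"
  shows "quarter_turn i j (rotating k l \<theta> x s) = 0"
  using assms by (simp add: quarter_turn_def rotating_def axis_component)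

lemma quarter_turn_central:
  assumes "i \<noteq> 9" "i \<noteq> 10" "j \<noteq> 9" "j \<noteq> 10"
  shows "quarter_turn i j (central u v) = 0"
  using assms by (simp add: quarter_turn_def central_component)

text \<open>The four quarter turns act on disjoint coordinate pairs and kill the centre, so the sum
  of four explicit rotations and a constant central vector is a solution.\<close>

lemma block_rotation_flow:
  "\<exists>c. c 0 = x \<and> (\<forall>s. (c has_vector_derivative block_rotation t a y (c s)) (at s))"
proof -
  let ?c = "\<lambda>s. rotating 1 2 (2 * y $ 9 / a $ 1) x s + rotating 3 4 (2 * y $ 10 / a $ 2) x s +
    rotating 5 6 (2 * (y $ 9 + y $ 10) / a $ 3) x s +
    rotating 7 8 (2 * (y $ 9 + t * y $ 10)) x s + central (x $ 9) (x $ 10)"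
  have "(?c has_vector_derivative
      (2 * y $ 9 / a $ 1) *\<^sub>R quarter_turn 1 2 (rotating 1 2 (2 * y $ 9 / a $ 1) x s) +
      (2 * y $ 10 / a $ 2) *\<^sub>R quarter_turn 3 4 (rotating 3 4 (2 * y $ 10 / a $ 2) x s) +
      (2 * (y $ 9 + y $ 10) / a $ 3) *\<^sub>R
        quarter_turn 5 6 (rotating 5 6 (2 * (y $ 9 + y $ 10) / a $ 3) x s) +
      (2 * (y $ 9 + t * y $ 10)) *\<^sub>R
        quarter_turn 7 8 (rotating 7 8 (2 * (y $ 9 + t * y $ 10)) x s) + 0) (at s)" for s
    by (intro has_vector_derivative_add rotating_deriv has_vector_derivative_const) simp_all
  then have "(?c has_vector_derivative block_rotation t a y (?c s)) (at s)" for s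
    by (simp add: block_rotation_def quarter_turn_add quarter_turn_rotating_disjoint
        quarter_turn_central)
  moreover have "?c 0 = x"
    by (simp add: vec_eq_iff forall_10 rotating_def axis_component central_component)
  ultimately show ?thesis by (intro exI[of _ ?c]) blast
qed

lemma geodesic_orbit_bracket:
  assumes "a $ 1 > 0" "a $ 2 > 0" "a $ 3 > 0"
  shows "geodesic_orbit_bracket (bracket t) (block_ip a) (block_rotation t a)"
proof (intro geodesic_orbit_bracket.intro geodesic_orbit_bracket_axioms.intro)
  show "two_step_bracket (bracket t)" by unfold_locales
  show "bounded_bilinear (block_ip a)" by (rule bounded_bilinear_block_ip)
  show "bounded_bilinear (block_rotation t a)" by (rule bounded_bilinear_block_rotation)
  fix x y z u v w :: "real ^ 10"
  show "block_ip a x y = block_ip a y x"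
    by (simp add: block_ip_def mult.commute)
  show "block_ip a x x > 0" if "x \<noteq> 0"
  proof -
    have nonneg: "a $ 1 * (x $ 1 * x $ 1 + x $ 2 * x $ 2) \<ge> 0"
      "a $ 2 * (x $ 3 * x $ 3 + x $ 4 * x $ 4) \<ge> 0"
      "a $ 3 * (x $ 5 * x $ 5 + x $ 6 * x $ 6) \<ge> 0" "x $ 7 * x $ 7 + x $ 8 * x $ 8 \<ge> 0"
      "x $ 9 * x $ 9 \<ge> 0" "x $ 10 * x $ 10 \<ge> 0"
      using assms by simp_all
    have "x = 0" if "block_ip a x x = 0"
    proof -
      have "a $ 1 * (x $ 1 * x $ 1 + x $ 2 * x $ 2) = 0"
        "a $ 2 * (x $ 3 * x $ 3 + x $ 4 * x $ 4) = 0"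
        "a $ 3 * (x $ 5 * x $ 5 + x $ 6 * x $ 6) = 0" "x $ 7 * x $ 7 + x $ 8 * x $ 8 = 0"
        "x $ 9 * x $ 9 = 0" "x $ 10 * x $ 10 = 0"
        using that nonneg unfolding block_ip_def by linarith+
      with assms show ?thesis
        by (simp add: vec_eq_iff forall_10 sum_squares_eq_zero_iff)
    qed
    moreover have "block_ip a x x \<ge> 0"
      using nonneg unfolding block_ip_def by linarith
    ultimately show ?thesis using \<open>x \<noteq> 0\<close> by fastforce
  qed
  show "block_ip a (block_rotation t a y u) v + block_ip a u (block_rotation t a y v) = 0"
    by (simp add: block_ip_def block_rotation_component algebra_simps)
  show "block_rotation t a y (bracket t u v) =
      bracket t (block_rotation t a y u) v + bracket t u (block_rotation t a y v)"
    by (simp add: vec_eq_iff forall_10 bracket_def area_def central_component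
        block_rotation_component algebra_simps)
  \<comment> \<open>The first argument enters only through its central coordinates 9 and 10, and
    rotated vectors have none.\<close>
  show "block_rotation t a (block_rotation t a x y) z = 0"
    by (simp add: vec_eq_iff forall_10 block_rotation_component)
  show "block_ip a (block_rotation t a y y) w = 2 * block_ip a y (bracket t y w)"
    using assms by (simp add: block_ip_def block_rotation_component bracket_def area_def
        central_component field_simps)
  show "\<exists>c. c 0 = x \<and> (\<forall>s. (c has_vector_derivative block_rotation t a y (c s)) (at s))"
    by (rule block_rotation_flow)
qed

section \<open>Dependence on the parameters\<close>

lemma prod_topology_top_of_set_euclidean:
  "prod_topology (top_of_set I) euclidean = top_of_set (I \<times> UNIV)"
  by (simp add: subtopology_Times[of euclidean euclidean I UNIV, simplified])

lemma continuous_lie_family_bracket: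
  "continuous_lie_family I (\<lambda>t. two_step_group (bracket t))"
proof -
  have "continuous_on (I \<times> UNIV \<times> UNIV) (\<lambda>(t, x, y). x + y + bracket t x y)"
    unfolding bracket_def area_def central_def split_def
    by (intro continuous_intros)
  moreover have "continuous_on (I \<times> UNIV) (\<lambda>(t, x::real ^ 10). - x)"
    unfolding split_def by (intro continuous_intros)
  ultimately show ?thesis
    by (auto simp: continuous_lie_family_def lie_group_two_step prod_topology_top_of_set_euclidean
        intro!: exI[of _ euclidean_manifold])
qed

lemma continuous_metric_family_bracket:
  "continuous_metric_family euclidean_manifold P (\<lambda>a. left_metric (bracket t) (block_ip a))"
proof -
  have "continuous_on (P \<times> UNIV) (\<lambda>(a, x). left_metric (bracket t) (block_ip a) c x v w)" for c v w
    unfolding left_metric_def block_ip_def bracket_def area_def central_def split_def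
    by (intro continuous_intros)
  then show ?thesis by (simp add: continuous_metric_family_def)
qed

text \<open>At the identity the tensor is \<open>block_ip a\<close> itself; one unit vector from
  each of the first three planes reads off the scales.\<close>

lemma same_metric_bracket_imp_eq:
  assumes "same_metric euclidean_manifold (left_metric (bracket t) (block_ip a))
    (left_metric (bracket t) (block_ip b))"
  shows "a = b"
proof -
  have "block_ip a v v = block_ip b v v" for v
    using assms[unfolded same_metric_def left_metric_def] zero_left by simp (metis diff_zero)
  from this[of "axis 1 1"] this[of "axis 3 1"] this[of "axis 5 1"] show ?thesis
    by (simp add: block_ip_def axis_component vec_eq_iff forall_3)
qed

section \<open>The groups of the family are pairwise non-isomorphic\<close>

text \<open>Additivity makes \<open>f h / h\<close> constant along \<open>h = x / n\<close>, and
  this sequence of quotients tends to the derivative. A Lie isomorphism is a priori only additive on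
  the centre; its smoothness then makes it linear there.\<close>

lemma additive_differentiable_imp_linear:
  fixes f :: "real \<Rightarrow> real"
  assumes add: "\<And>x y. f (x + y) = f x + f y" and d: "(f has_real_derivative d) (at 0)"
  shows "f x = x * d"
proof (cases "x = 0")
  case True
  then show ?thesis using add[of 0 0] by simp
next
  case False
  have "f 0 = 0" using add[of 0 0] by simp
  have mult: "f (of_nat n * y) = of_nat n * f y" for n y
    by (induction n) (simp_all add: \<open>f 0 = 0\<close> add distrib_right)
  have "f (x / of_nat (Suc n)) = f x / of_nat (Suc n)" for n
    using mult[of "Suc n" "x / of_nat (Suc n)"] by (simp add: field_simps del: of_nat_Suc)
  then have quot: "f (x / of_nat (Suc n)) / (x / of_nat (Suc n)) = f x / x" for n
    by (simp del: of_nat_Suc)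
  have "(\<lambda>n. x / of_nat (Suc n)) \<longlonglongrightarrow> 0"
    by (rule LIMSEQ_Suc) (rule lim_const_over_n)
  then have "filterlim (\<lambda>n. x / of_nat (Suc n)) (at 0) sequentially"
    using False by (intro filterlim_atI) (auto simp del: of_nat_Suc)
  moreover have "(\<lambda>h. f h / h) \<midarrow>0\<rightarrow> d"
    using d \<open>f 0 = 0\<close> by (simp add: DERIV_def)
  ultimately have "(\<lambda>n. f (x / of_nat (Suc n)) / (x / of_nat (Suc n))) \<longlonglongrightarrow> d"
    by (rule filterlim_compose[rotated])
  then have "f x / x = d"
    unfolding quot by (simp add: LIMSEQ_const_iff)
  then show ?thesis using False by (simp add: field_simps)
qed

text \<open>The homogeneous coordinates \<open>(weight1 j, weight2 t j)\<close> of the four lines.\<close>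

definition weight1 :: "nat \<Rightarrow> real" where
  "weight1 j = (if j = 2 then 0 else 1)"

definition weight2 :: "real \<Rightarrow> nat \<Rightarrow> real" where
  "weight2 t j = (if j = 1 then 0 else if j = 4 then t else 1)"

definition weight_det :: "real \<Rightarrow> nat \<Rightarrow> nat \<Rightarrow> real" where
  "weight_det t i j = weight1 i * weight2 t j - weight2 t i * weight1 j"

text \<open>Nonzero products force the four indices to be distinct. For each permutation the
  absolute values are \<open>1 - t\<close>, \<open>1\<close> and \<open>t\<close> in some order, and
  symmetric functions of them ignore the order.\<close>

lemma weight_det_products:
  assumes "0 < t" "t < 1 / 2" "i \<in> {1, 2, 3, 4}" "j \<in> {1, 2, 3, 4}" "k \<in> {1, 2, 3, 4}" "l \<in> {1, 2, 3, 4}"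
    and "P = weight_det t i j * weight_det t k l" "Q = weight_det t i k * weight_det t j l"
    "R = weight_det t i l * weight_det t j k" "P \<noteq> 0" "Q \<noteq> 0" "R \<noteq> 0"
  shows "\<bar>P\<bar> + \<bar>Q\<bar> + \<bar>R\<bar> = 2 \<and> \<bar>P\<bar> * \<bar>Q\<bar> * \<bar>R\<bar> = t * (1 - t)"
proof -
  have "i \<noteq> j" "k \<noteq> l" "i \<noteq> k" "j \<noteq> l" "i \<noteq> l" "j \<noteq> k"
    using assms(7-12) by (auto simp: weight_det_def)
  moreover have "\<bar>t\<bar> = t" "\<bar>t - 1\<bar> = 1 - t" "\<bar>1 - t\<bar> = 1 - t"
    using assms(1,2) by auto
  ultimately show ?thesis
    using assms(3-6) unfolding assms(7-9)
    by (elim insertE emptyE)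
      (simp_all add: weight_det_def weight1_def weight2_def)
qed

text \<open>The products \<open>d(1,2) d(3,4)\<close>, \<open>d(1,3) d(2,4)\<close>, \<open>d(1,4) d(2,3)\<close> of the determinants of the
  four vectors determine the four lines up to \<open>GL(2)\<close>. Up to order, sign and a common factor they
  do not depend on the order and scaling of the vectors, and up to sign they are \<open>1 - t\<close>, \<open>1\<close>, \<open>t\<close>.\<close>

lemma parameter_eq:
  assumes s: "0 < s" "s < 1 / 2" and t: "0 < t" "t < 1 / 2"
    and det: "p * q' - p' * q \<noteq> (0 :: real)"
    and lines: "\<And>k. k \<in> {1, 2, 3, 4} \<Longrightarrow> \<exists>j\<in>{1, 2, 3, 4}. \<exists>c.
      p * weight1 k + p' * weight2 s k = c * weight1 j \<and>
      q * weight1 k + q' * weight2 s k = c * weight2 t j"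
  shows "s = t"
proof -
  let ?d = "p * q' - p' * q"
  obtain \<sigma> c where \<sigma>: "\<And>k. k \<in> {1, 2, 3, 4} \<Longrightarrow> \<sigma> k \<in> {1, 2, 3, 4}"
    and eq: "\<And>k. k \<in> {1, 2, 3, 4} \<Longrightarrow> p * weight1 k + p' * weight2 s k = c k * weight1 (\<sigma> k)"
      "\<And>k. k \<in> {1, 2, 3, 4} \<Longrightarrow> q * weight1 k + q' * weight2 s k = c k * weight2 t (\<sigma> k)"
    using lines by metis
  have dets: "?d * weight_det s k l = c k * c l * weight_det t (\<sigma> k) (\<sigma> l)"
    if "k \<in> {1, 2, 3, 4}" "l \<in> {1, 2, 3, 4}" for k l
  proof -
    have "?d * weight_det s k l = (p * weight1 k + p' * weight2 s k) * (q * weight1 l + q' * weight2 s l) -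
        (q * weight1 k + q' * weight2 s k) * (p * weight1 l + p' * weight2 s l)"
      by (simp add: weight_det_def algebra_simps)
    also have "\<dots> = c k * c l * weight_det t (\<sigma> k) (\<sigma> l)"
      by (simp only: eq[OF that(1)] eq[OF that(2)]) (simp add: weight_det_def algebra_simps)
    finally show ?thesis .
  qed
  define C where "C = c 1 * c 2 * c 3 * c 4"
  define P where "P = weight_det t (\<sigma> 1) (\<sigma> 2) * weight_det t (\<sigma> 3) (\<sigma> 4)"
  define Q where "Q = weight_det t (\<sigma> 1) (\<sigma> 3) * weight_det t (\<sigma> 2) (\<sigma> 4)"
  define R where "R = weight_det t (\<sigma> 1) (\<sigma> 4) * weight_det t (\<sigma> 2) (\<sigma> 3)"
  \<comment> \<open>In each pairing of the four indices every scaling factor occurs once, so the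
    three products share the factor \<open>C\<close>.\<close>
  have products: "?d\<^sup>2 * (weight_det s i j * weight_det s k l) =
      (c i * c j * c k * c l) * (weight_det t (\<sigma> i) (\<sigma> j) * weight_det t (\<sigma> k) (\<sigma> l))"
    if "{i, j, k, l} \<subseteq> {1, 2, 3, 4}" for i j k l
  proof -
    have mem: "i \<in> {1, 2, 3, 4}" "j \<in> {1, 2, 3, 4}" "k \<in> {1, 2, 3, 4}" "l \<in> {1, 2, 3, 4}"
      using that by auto
    have "?d\<^sup>2 * (weight_det s i j * weight_det s k l) =
        (?d * weight_det s i j) * (?d * weight_det s k l)"
      by (simp add: power2_eq_square)
    also have "\<dots> = (c i * c j * weight_det t (\<sigma> i) (\<sigma> j)) * (c k * c l * weight_det t (\<sigma> k) (\<sigma> l))"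
      by (simp only: dets[OF mem(1,2)] dets[OF mem(3,4)])
    finally show ?thesis by (simp only: mult_ac)
  qed
  have P: "?d\<^sup>2 * (s - 1) = C * P"
    using products[of 1 2 3 4] by (simp add: C_def P_def weight_det_def weight1_def weight2_def)
  have Q: "?d\<^sup>2 * (- 1) = C * Q"
    using products[of 1 3 2 4] by (simp add: C_def Q_def weight_det_def weight1_def weight2_def)
  have R: "?d\<^sup>2 * (- s) = C * R"
    using products[of 1 4 2 3] by (simp add: C_def R_def weight_det_def weight1_def weight2_def)
  define K where "K = ?d\<^sup>2"
  have K: "K > 0" using det by (simp add: K_def)
  have "P \<noteq> 0" "Q \<noteq> 0" "R \<noteq> 0"
    using P Q R s det by auto
  then have inv: "\<bar>P\<bar> + \<bar>Q\<bar> + \<bar>R\<bar> = 2" "\<bar>P\<bar> * \<bar>Q\<bar> * \<bar>R\<bar> = t * (1 - t)"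
    using weight_det_products[OF t \<sigma> \<sigma> \<sigma> \<sigma> P_def Q_def R_def] by simp_all
  have abs: "K * (1 - s) = \<bar>C\<bar> * \<bar>P\<bar>" "K = \<bar>C\<bar> * \<bar>Q\<bar>" "K * s = \<bar>C\<bar> * \<bar>R\<bar>"
    using arg_cong[OF P, of abs] arg_cong[OF Q, of abs] arg_cong[OF R, of abs] s
    by (simp_all add: K_def abs_mult)
  \<comment> \<open>Both triples of absolute values have sum 2, which fixes the common
    factor.\<close>
  have "\<bar>C\<bar> * (\<bar>P\<bar> + \<bar>Q\<bar> + \<bar>R\<bar>) = 2 * K"
    by (simp only: distrib_left abs[symmetric]) (simp add: algebra_simps)
  then have "\<bar>C\<bar> = K" using inv(1) by simp
  then have "1 - s = \<bar>P\<bar>" "1 = \<bar>Q\<bar>" "s = \<bar>R\<bar>"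
    using abs K by auto
  then have "s * (1 - s) = t * (1 - t)"
    using inv(2) by (simp add: mult.commute)
  \<comment> \<open>The other solution \<open>t = 1 - s\<close> is excluded because both parameters
    lie below one half.\<close>
  then have "(s - t) * (1 - s - t) = 0" by (simp add: algebra_simps)
  then show ?thesis using s t by simp
qed

section \<open>Recovering the four lines from the bracket\<close>

definition first_axis :: "nat \<Rightarrow> 10" where
  "first_axis j = (if j = 1 then 1 else if j = 2 then 3 else if j = 3 then 5 else 7)"

definition second_axis :: "nat \<Rightarrow> 10" where
  "second_axis j = (if j = 1 then 2 else if j = 2 then 4 else if j = 3 then 6 else 8)"

lemmas axis_defs = first_axis_def second_axis_def

lemma bracket_axes:
  assumes "j \<in> {1, 2, 3, 4}"
  shows "bracket t (axis (first_axis j) 1) y = y $ second_axis j *\<^sub>R central (weight1 j) (weight2 t j)"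
    and "bracket t x (axis (second_axis j) 1) = x $ first_axis j *\<^sub>R central (weight1 j) (weight2 t j)"
    and "bracket t x (axis (first_axis j) 1) = - x $ second_axis j *\<^sub>R central (weight1 j) (weight2 t j)"
  using assms by (auto simp: bracket_def area_def axis_component axis_defs weight1_def weight2_def
      scaleR_central central_inject)

lemma bracket_eq_zeroI:
  assumes "\<And>j. j \<in> {1, 2, 3, 4} \<Longrightarrow> x $ first_axis j = 0 \<and> x $ second_axis j = 0"
  shows "bracket t x y = 0"
  using assms[of 1] assms[of 2] assms[of 3] assms[of 4]
  by (simp add: bracket_def area_def axis_defs vec_eq_iff central_component)

text \<open>An isomorphism preserves commutators, hence maps the central plane to the central plane,
  where it acts by an invertible matrix with rows \<open>p\<close>, \<open>p'\<close> and
  \<open>q\<close>, \<open>q'\<close>. This matrix permutes the two sets of four lines, so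
  \<open>parameter_eq\<close> applies.\<close>

lemma lie_isomorphic_bracket_imp_eq:
  assumes s: "0 < s" "s < 1 / 2" and t: "0 < t" "t < 1 / 2"
    and iso: "lie_isomorphic (two_step_group (bracket s)) (two_step_group (bracket t))"
  shows "s = t"
proof -
  let ?G = "two_step_group (bracket s)" and ?H = "two_step_group (bracket t)"
  obtain f where f: "f \<in> iso ?G ?H" and diffeo: "diffeomorphism euclidean_manifold euclidean_manifold f"
    using iso by (auto simp: lie_isomorphic_def)
  have bij: "bij f" using f by (simp add: iso_def)
  have hom: "f (x + y + bracket s x y) = f x + f y + bracket t (f x) (f y)" for x y
    using f by (auto simp: iso_def hom_def)
  interpret f: group_hom ?G ?H f
    using f by (intro group_hom.intro group_hom_axioms.intro group_two_step) (simp add: iso_def)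
  have f_0: "f 0 = 0" using f.hom_one by simp
  have f_minus: "f (- x) = - f x" for x using f.hom_inv[of x] by simp
  have f_bracket: "f (2 *\<^sub>R bracket s x y) = 2 *\<^sub>R bracket t (f x) (f y)" for x y
    unfolding commutator_two_step[symmetric] by (simp only: hom f_minus)
  have "f differentiable (at 0)"
  proof -
    have "smooth_on f UNIV"
      using diffeo by (simp add: diffeomorphism_def smooth_map_euclidean)
    then have "C_k_on (Suc 0) f UNIV" unfolding smooth_on_def by blast
    then show ?thesis by simp
  qed
  then obtain f' where f': "(f has_derivative f') (at 0)" by (auto simp: differentiable_def)
  \<comment> \<open>The first two planes suffice, since their lines are the two coordinate axes of
    the centre.\<close>
  have central_bracket: "\<exists>x y. central u v = 2 *\<^sub>R bracket s x y" for u v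
    by (rule exI[of _ "axis 1 1 + axis 3 1"], rule exI[of _ "(u / 2) *\<^sub>R axis 2 1 + (v / 2) *\<^sub>R axis 4 1"])
      (simp add: bracket_def area_def axis_component scaleR_central)
  have f_central: "\<exists>u' v'. f (central u v) = central u' v'" for u v
    using central_bracket[of u v] f_bracket by (metis bracket_def scaleR_central)
  have bracket_central: "bracket r (central u v) x = 0" for r u v x
    by (rule bracket_eq_zeroI) (auto simp: central_component axis_defs)
  have f_add: "f (central u v + central u' v') = f (central u v) + f (central u' v')" for u v u' v'
    using hom[of "central u v" "central u' v'"] f_central[of u v] bracket_central by force
  have f_lin: "\<exists>d. \<forall>r. f (central (r * u) (r * v)) $ i = r * d" for u v i
  proof -
    let ?z = "central u v"
    have "((\<lambda>r. r *\<^sub>R ?z) has_derivative (\<lambda>r. r *\<^sub>R ?z)) (at 0)"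
      by (auto intro!: derivative_eq_intros)
    moreover have "(f has_derivative f') (at (0 *\<^sub>R ?z))" using f' by simp
    ultimately have "((\<lambda>r. f (r *\<^sub>R ?z)) has_derivative (\<lambda>r. f' (r *\<^sub>R ?z))) (at 0)"
      by (rule has_derivative_compose)
    then have "((\<lambda>r. f (r *\<^sub>R ?z)) has_vector_derivative f' ?z) (at 0)"
      using linear_cmul[OF has_derivative_linear[OF f']] by (simp add: has_vector_derivative_def)
    then have "((\<lambda>r. f (r *\<^sub>R ?z) $ i) has_real_derivative f' ?z $ i) (at 0)"
      unfolding has_real_derivative_iff_has_vector_derivative
      by (rule bounded_linear.has_vector_derivative[OF bounded_linear_vec_nth])
    moreover have "f ((r + r') *\<^sub>R ?z) $ i = f (r *\<^sub>R ?z) $ i + f (r' *\<^sub>R ?z) $ i" for r r'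
      using f_add[of "r * u" "r * v" "r' * u" "r' * v"]
      by (simp add: scaleR_central central_add distrib_right)
    ultimately have "f (r *\<^sub>R ?z) $ i = r * (f' ?z $ i)" for r
      by (intro additive_differentiable_imp_linear[of "\<lambda>r. f (r *\<^sub>R ?z) $ i"])
    then show ?thesis by (auto simp: scaleR_central)
  qed
  obtain p where p: "\<And>r. f (central (r * 1) (r * 0)) $ 9 = r * p" using f_lin by metis
  obtain q where q: "\<And>r. f (central (r * 1) (r * 0)) $ 10 = r * q" using f_lin by metis
  obtain p' where p': "\<And>r. f (central (r * 0) (r * 1)) $ 9 = r * p'" using f_lin by metis
  obtain q' where q': "\<And>r. f (central (r * 0) (r * 1)) $ 10 = r * q'" using f_lin by metis
  have f_eq: "f (central u v) = central (p * u + p' * v) (q * u + q' * v)" for u v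
  proof -
    obtain u1 v1 where 1: "f (central u 0) = central u1 v1" using f_central by blast
    obtain u2 v2 where 2: "f (central 0 v) = central u2 v2" using f_central by blast
    have "f (central u v) = central (u1 + u2) (v1 + v2)"
      using f_add[of u 0 0 v] by (simp add: central_add 1 2)
    moreover have "u1 = p * u" "v1 = q * u" "u2 = p' * v" "v2 = q' * v"
      using p[of u] q[of u] p'[of v] q'[of v] by (simp_all add: 1 2 central_component)
    ultimately show ?thesis by simp
  qed
  have f_inj: "u = 0 \<and> v = 0" if "p * u + p' * v = 0" "q * u + q' * v = 0" for u v
  proof -
    have "f (central u v) = f (central 0 0)"
      by (simp add: f_eq that)
    then have "central u v = central 0 0" using bij by (metis bij_pointE)
    then show ?thesis by (simp add: central_inject)
  qed
  have det: "p * q' - p' * q \<noteq> 0"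
  proof
    assume "p * q' - p' * q = 0"
    \<comment> \<open>With zero determinant, both \<open>(p', - p)\<close> and
      \<open>(q', - q)\<close> lie in the kernel of the matrix.\<close>
    then have "p' = 0 \<and> p = 0" "q' = 0 \<and> q = 0"
      using f_inj[of "p'" "- p"] f_inj[of "q'" "- q"] by (simp_all add: algebra_simps)
    then show False using f_inj[of 1 0] by simp
  qed
  show ?thesis
  proof (rule parameter_eq[OF s t det])
    fix k :: nat
    assume k: "k \<in> {1, 2, 3, 4}"
    define u v where "u = weight1 k" "v = weight2 s k"
    have uv: "u \<noteq> 0 \<or> v \<noteq> 0" using k by (auto simp: u_v_def weight1_def weight2_def)
    let ?F = "f (axis (first_axis k) 1)" and ?w = "central (p * u + p' * v) (q * u + q' * v)"
    \<comment> \<open>Every \<open>y\<close> is an image under \<open>f\<close>, and brackets with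
      the axis vector stay on the \<open>k\<close>-th line, whose image is spanned by
      \<open>?w\<close>.\<close>
    have F: "\<exists>c. bracket t ?F y = c *\<^sub>R ?w" for y
    proof -
      obtain x where x: "y = f x" using bij by (metis bij_pointE)
      have "2 *\<^sub>R bracket t ?F y = f (2 *\<^sub>R x $ second_axis k *\<^sub>R central u v)"
        using k by (simp add: x f_bracket[symmetric] bracket_axes u_v_def)
      also have "\<dots> = 2 *\<^sub>R (x $ second_axis k *\<^sub>R ?w)"
        by (simp add: scaleR_central f_eq algebra_simps)
      finally have "bracket t ?F y = x $ second_axis k *\<^sub>R ?w" by (rule scaleR_left_imp_eq[rotated]) simp
      then show ?thesis by blast
    qed
    \<comment> \<open>Otherwise \<open>?F\<close> would be central, and \<open>f\<close> would kill
      a nonzero central vector.\<close>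
    obtain j where j: "j \<in> {1, 2, 3, 4}" and nz: "?F $ first_axis j \<noteq> 0 \<or> ?F $ second_axis j \<noteq> 0"
    proof -
      have "\<exists>j\<in>{1, 2, 3, 4}. ?F $ first_axis j \<noteq> 0 \<or> ?F $ second_axis j \<noteq> 0"
      proof (rule ccontr)
        assume "\<not> ?thesis"
        then have "bracket t ?F y = 0" for y by (intro bracket_eq_zeroI) blast
        then have "f (2 *\<^sub>R bracket s (axis (first_axis k) 1) (axis (second_axis k) 1)) = 0"
          by (simp add: f_bracket)
        then have "f (central (2 * u) (2 * v)) = 0"
          using k by (simp add: bracket_axes u_v_def scaleR_central axis_component)
        then have "p * (2 * u) + p' * (2 * v) = 0 \<and> q * (2 * u) + q' * (2 * v) = 0"
          unfolding f_eq by (simp add: vec_eq_iff forall_10 central_component)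
        then show False using f_inj[of "2 * u" "2 * v"] uv by simp
      qed
      then show ?thesis using that by blast
    qed
    \<comment> \<open>Bracketing \<open>?F\<close> with an axis vector of plane \<open>j\<close>
      isolates its nonzero coordinate there and yields a vector on the \<open>j\<close>-th
      line.\<close>
    have "\<exists>c. c \<noteq> 0 \<and> (\<exists>d. c *\<^sub>R central (weight1 j) (weight2 t j) = d *\<^sub>R ?w)"
      using nz F[of "axis (second_axis j) 1"] F[of "axis (first_axis j) 1"]
      unfolding bracket_axes(2,3)[OF j] by (metis neg_equal_0_iff_equal)
    then obtain c d where c: "c \<noteq> 0" and cd: "c * weight1 j = d * (p * u + p' * v)"
      "c * weight2 t j = d * (q * u + q' * v)"
      by (auto simp: scaleR_central central_inject)
    have "weight1 j \<noteq> 0 \<or> weight2 t j \<noteq> 0" using j by (auto simp: weight1_def weight2_def)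
    then have "d \<noteq> 0" using c cd by auto
    then have "p * u + p' * v = c / d * weight1 j \<and> q * u + q' * v = c / d * weight2 t j"
      using cd by (simp add: field_simps)
    then show "\<exists>j\<in>{1, 2, 3, 4}. \<exists>c. p * weight1 k + p' * weight2 s k = c * weight1 j \<and>
        q * weight1 k + q' * weight2 s k = c * weight2 t j"
      using j unfolding u_v_def by blast
  qed
qed

theorem theorem1:
  shows "\<exists>(I :: real set) (N :: real \<Rightarrow> (real ^ 10, real ^ 10) lie_structure).
    open I \<and> connected I \<and> I \<noteq> {} \<and>
    continuous_lie_family I N \<and>
    (\<forall>t\<in>I. lie_group (N t) \<and> nilpotent_group (N t) \<and>
       connected_space (mtop (manifold (N t))) \<and>
       simply_connected_space (mtop (manifold (N t)))) \<and>
    (\<forall>s\<in>I. \<forall>t\<in>I. s \<noteq> t \<longrightarrow> \<not> lie_isomorphic (N s) (N t)) \<and>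
    (\<forall>t\<in>I. \<exists>(P :: (real ^ 3) set) (g :: real ^ 3 \<Rightarrow> (real ^ 10, real ^ 10) metric_tensor).
       open P \<and> connected P \<and> P \<noteq> {} \<and>
       continuous_metric_family (manifold (N t)) P g \<and>
       (\<forall>a\<in>P. left_invariant_metric (N t) (g a) \<and>
          geodesic_orbit_metric (manifold (N t)) (g a)) \<and>
       (\<forall>a\<in>P. \<forall>b\<in>P. a \<noteq> b \<longrightarrow> \<not> same_metric (manifold (N t)) (g a) (g b)))"
proof -
  let ?N = "\<lambda>t. two_step_group (bracket t)"
  let ?I = "{0<..<1 / 2 :: real}"
  have metrics: "\<exists>(P :: (real ^ 3) set) g. open P \<and> connected P \<and> P \<noteq> {} \<and>
      continuous_metric_family (manifold (?N t)) P g \<and>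
      (\<forall>a\<in>P. left_invariant_metric (?N t) (g a) \<and> geodesic_orbit_metric (manifold (?N t)) (g a)) \<and>
      (\<forall>a\<in>P. \<forall>b\<in>P. a \<noteq> b \<longrightarrow> \<not> same_metric (manifold (?N t)) (g a) (g b))" for t
  proof (intro exI conjI ballI impI)
    \<comment> \<open>The unit ball around the all-ones vector is a connected open set in which all
      three scales are positive.\<close>
    let ?P = "ball (1 :: real ^ 3) 1" and ?g = "\<lambda>a. left_metric (bracket t) (block_ip a)"
    show "open ?P" "connected ?P" "?P \<noteq> {}" by simp_all
    show "continuous_metric_family (manifold (?N t)) ?P ?g"
      by (simp add: continuous_metric_family_bracket)
    fix a assume a: "a \<in> ?P"
    have "a $ i > 0" for i
      using a component_le_norm_cart[of "1 - a" i] by (simp add: dist_norm)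
    then have "geodesic_orbit_bracket (bracket t) (block_ip a) (block_rotation t a)"
      by (intro geodesic_orbit_bracket)
    then show "left_invariant_metric (?N t) (?g a)" "geodesic_orbit_metric (manifold (?N t)) (?g a)"
      using geodesic_orbit_bracket.left_invariant_metric geodesic_orbit_bracket.geodesic_orbit
      by auto
    show "\<not> same_metric (manifold (?N t)) (?g a) (?g b)" if "a \<noteq> b" for b
      using that same_metric_bracket_imp_eq by auto
  qed
  show ?thesis
  proof (intro exI[of _ ?I] exI[of _ ?N] conjI ballI impI metrics)
    show "open ?I" "connected ?I" "?I \<noteq> {}" by simp_all
    show "continuous_lie_family ?I ?N" by (rule continuous_lie_family_bracket)
    show "\<not> lie_isomorphic (?N s) (?N t)" if "s \<in> ?I" "t \<in> ?I" "s \<noteq> t" for s t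
      using that lie_isomorphic_bracket_imp_eq by auto
    show "connected_space (mtop (manifold (?N t)))" for t
      using connectedin_iff_connected[of "UNIV :: (real ^ 10) set"] convex_connected[OF convex_UNIV]
      by (auto simp: connectedin_def)
  qed (simp_all add: lie_group_two_step nilpotent_two_step simply_connected_space_euclidean)
qed

end
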